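(* There is an algorithm which, given oracle access to a directed graph $G$ with $n$ vertices and $m$ edges, together with a vertex $v^*$ and parameters $T\in\mathbb{N}$ and $\delta>0$, returns a number $\rho$ with the following guarantee: if the random walk on $G$ has stationary distribution $\pi$ and mixes in time $T$ with accuracy $\varepsilon$, then $|\rho-\pi(v^* )|\le\varepsilon+\delta$. The algorithm runs in time $\widetilde{O}(Tm/\delta)$ and uses space $\widetilde{O}(n)$.
   Context: The random walk on $G$ moves at each step along a uniformly random outgoing edge of the current vertex; its random walk matrix $W\in\mathbb{R}^{n\times n}$ has $W_{w,u}$ equal to the number of edges from $u$ to $w$ divided by the out-degree of $u$. A probability vector is a vector in $\mathbb{R}^n$ with nonnegative entries summing to $1$. A matrix is (left) stochastic if every column is a probability vector. A stationary distribution of a stochastic matrix $W$ is a probability vector $\pi$ with $W\pi=\pi$. $W$ mixes in time $T$ with accuracy $\varepsilon$ if its stationary distribution $\pi$ is unique and $\|W^T v-\pi\|_1\le\varepsilon$ for every probability vector $v$, where $W^T$ denotes the $T$-th power of $W$. Oracle access to $G$: vertex set $[n]$, with in-degree, out-degree, $i$-th in-neighbor and $i$-th out-neighbor queries. $\widetilde{O}(\cdot)$ hides polylogarithmic factors. *)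

theory Defs
  imports
    Complex_Main
    "HOL-Library.Log_Nat"
    "Graph_Theory.Digraph"
    "Jordan_Normal_Form.Matrix"
begin

section \<open>Random walks\<close>

text \<open>
  A graph on the vertex set $[n]$ is a finite multi-digraph with vertices \<open>{..<n}\<close>; loops and
  parallel arcs are allowed. Its arcs are named by natural numbers so that a single type
  covers all finite graphs.
\<close>

type_synonym graph = "(nat, nat) pre_digraph"

definition graph_on :: "nat \<Rightarrow> graph \<Rightarrow> bool" where
  "graph_on n G \<longleftrightarrow> fin_digraph G \<and> verts G = {..<n}"

definition num_arcs_betw :: "graph \<Rightarrow> nat \<Rightarrow> nat \<Rightarrow> nat" where
  "num_arcs_betw G u w = card {e \<in> arcs G. tail G e = u \<and> head G e = w}"

text \<open>
  If \<open>u\<close> has no outgoing arc, its column is zero (division by zero), so the matrix is not stochastic.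
\<close>

definition random_walk_mat :: "graph \<Rightarrow> real mat" where
  "random_walk_mat G =
     (let n = card (verts G)
      in mat n n (\<lambda>(w, u). real (num_arcs_betw G u w) / real (out_degree G u)))"

definition prob_vec :: "nat \<Rightarrow> real vec \<Rightarrow> bool" where
  "prob_vec n v \<longleftrightarrow> v \<in> carrier_vec n \<and> (\<forall>i<n. 0 \<le> v $ i) \<and> (\<Sum>i<n. v $ i) = 1"

definition stochastic_mat :: "real mat \<Rightarrow> bool" where
  "stochastic_mat W \<longleftrightarrow> square_mat W \<and> (\<forall>j<dim_col W. prob_vec (dim_row W) (col W j))"

definition stationary_distribution :: "real mat \<Rightarrow> real vec \<Rightarrow> bool" where
  "stationary_distribution W \<pi> \<longleftrightarrow>
     stochastic_mat W \<and> prob_vec (dim_row W) \<pi> \<and> W *\<^sub>v \<pi> = \<pi>"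

definition l1_norm :: "real vec \<Rightarrow> real" where
  "l1_norm v = (\<Sum>i<dim_vec v. \<bar>v $ i\<bar>)"

definition mixes :: "real mat \<Rightarrow> nat \<Rightarrow> real \<Rightarrow> bool" where
  "mixes W T \<epsilon> \<longleftrightarrow>
     (\<exists>\<pi>. stationary_distribution W \<pi>
        \<and> (\<forall>\<pi>'. stationary_distribution W \<pi>' \<longrightarrow> \<pi>' = \<pi>)
        \<and> (\<forall>v. prob_vec (dim_row W) v \<longrightarrow> l1_norm ((W ^\<^sub>m T) *\<^sub>v v - \<pi>) \<le> \<epsilon>))"


section \<open>Oracle access\<close>

record query_oracle =
  q_indeg  :: "nat \<Rightarrow> nat"
  q_outdeg :: "nat \<Rightarrow> nat"
  q_innbr  :: "nat \<Rightarrow> nat \<Rightarrow> nat"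
  q_outnbr :: "nat \<Rightarrow> nat \<Rightarrow> nat"
  q_delta  :: "nat \<Rightarrow> nat \<Rightarrow> bool"

text \<open>
  The neighbours of a vertex are listed with multiplicity, in an arbitrary order, and numbered
  from \<open>0\<close>; answers to out-of-range queries are unspecified. The real parameter \<open>\<delta>\<close>
  is accessed by comparing it with nonnegative rational numbers \<open>a / b\<close>.
\<close>

definition oracle_access :: "query_oracle \<Rightarrow> graph \<Rightarrow> real \<Rightarrow> bool" where
  "oracle_access Q G \<delta> \<longleftrightarrow>
     (\<forall>u\<in>verts G.
        q_indeg Q u = in_degree G u \<and>
        q_outdeg Q u = out_degree G u \<and>
        (\<exists>e. bij_betw e {..<in_degree G u} (in_arcs G u) \<and>
             (\<forall>i<in_degree G u. q_innbr Q u i = tail G (e i))) \<and>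
        (\<exists>e. bij_betw e {..<out_degree G u} (out_arcs G u) \<and>
             (\<forall>i<out_degree G u. q_outnbr Q u i = head G (e i)))) \<and>
     (\<forall>a b. q_delta Q a b \<longleftrightarrow> real a \<le> \<delta> * real b)"


section \<open>Machine model\<close>

text \<open>
  Algorithms are structured programs for a random access machine with the logarithmic cost
  criterion (Aho, Hopcroft and Ullman): memory cells hold arbitrary natural numbers,
  and touching a cell costs the number of bits of its address and of its content. Measuring time
  and space in bits rules out hiding work in large integers, and differs from a
  word RAM with words of logarithmic length only by polylogarithmic factors.

  An instruction writes a single cell. Its first argument is the address of that cell, except for
  \<open>STORE a b\<close>, which writes to the cell whose address is the content of \<open>a\<close>. The remaining
  arguments are addresses of operands, except for the constant in \<open>SET\<close>; \<open>LOAD a b\<close> reads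
  the cell whose address is the content of \<open>b\<close>. Subtraction is truncated, division rounds
  down, and a quotient by zero is zero.
\<close>

type_synonym mem = "nat \<Rightarrow> nat"

datatype instr =
    SET nat nat
  | COPY nat nat
  | ADD nat nat nat
  | SUB nat nat nat
  | MUL nat nat nat
  | DIV nat nat nat
  | LOAD nat nat
  | STORE nat nat
  | INDEG nat nat
  | OUTDEG nat nat
  | INNBR nat nat nat
  | OUTNBR nat nat nat
  | DELTA nat nat nat

datatype prog =
    SKIP
  | INSTR instr
  | SEQ prog prog
  | IFNZ nat prog prog
  | WHILENZ nat prog

fun target :: "instr \<Rightarrow> mem \<Rightarrow> nat" where
  "target (SET a c) M = a"
| "target (COPY a b) M = a"
| "target (ADD a b c) M = a"
| "target (SUB a b c) M = a"
| "target (MUL a b c) M = a"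
| "target (DIV a b c) M = a"
| "target (LOAD a b) M = a"
| "target (STORE a b) M = M a"
| "target (INDEG a u) M = a"
| "target (OUTDEG a u) M = a"
| "target (INNBR a u i) M = a"
| "target (OUTNBR a u i) M = a"
| "target (DELTA a b c) M = a"

fun result :: "query_oracle \<Rightarrow> instr \<Rightarrow> mem \<Rightarrow> nat" where
  "result Q (SET a c) M = c"
| "result Q (COPY a b) M = M b"
| "result Q (ADD a b c) M = M b + M c"
| "result Q (SUB a b c) M = M b - M c"
| "result Q (MUL a b c) M = M b * M c"
| "result Q (DIV a b c) M = M b div M c"
| "result Q (LOAD a b) M = M (M b)"
| "result Q (STORE a b) M = M b"
| "result Q (INDEG a u) M = q_indeg Q (M u)"
| "result Q (OUTDEG a u) M = q_outdeg Q (M u)"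
| "result Q (INNBR a u i) M = q_innbr Q (M u) (M i)"
| "result Q (OUTNBR a u i) M = q_outnbr Q (M u) (M i)"
| "result Q (DELTA a b c) M = of_bool (q_delta Q (M b) (M c))"

fun cells_read :: "instr \<Rightarrow> mem \<Rightarrow> nat list" where
  "cells_read (SET a c) M = []"
| "cells_read (COPY a b) M = [b]"
| "cells_read (ADD a b c) M = [b, c]"
| "cells_read (SUB a b c) M = [b, c]"
| "cells_read (MUL a b c) M = [b, c]"
| "cells_read (DIV a b c) M = [b, c]"
| "cells_read (LOAD a b) M = [b, M b]"
| "cells_read (STORE a b) M = [a, b]"
| "cells_read (INDEG a u) M = [u]"
| "cells_read (OUTDEG a u) M = [u]"
| "cells_read (INNBR a u i) M = [u, i]"
| "cells_read (OUTNBR a u i) M = [u, i]"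
| "cells_read (DELTA a b c) M = [b, c]"

definition bits :: "nat \<Rightarrow> nat" where
  "bits x = max 1 (floorlog 2 x)"

definition cell_cost :: "nat \<Rightarrow> nat \<Rightarrow> nat" where
  "cell_cost a x = bits a + bits x"

definition instr_cost :: "query_oracle \<Rightarrow> instr \<Rightarrow> mem \<Rightarrow> nat" where
  "instr_cost Q i M =
     1 + (\<Sum>a\<leftarrow>cells_read i M. cell_cost a (M a)) + cell_cost (target i M) (result Q i M)"

text \<open>
  The size of a memory is the length of its description as a list of pairs of address and
  content. Memories reachable from an input have only finitely many nonzero cells.
\<close>

definition mem_size :: "mem \<Rightarrow> nat" where
  "mem_size M = (\<Sum>a\<in>{a. M a \<noteq> 0}. cell_cost a (M a))"

text \<open>
  \<open>exec Q p M t s M'\<close>: with oracle \<open>Q\<close>, the program \<open>p\<close> started in memory \<open>M\<close> halts with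
  memory \<open>M'\<close>, after time \<open>t\<close>, and \<open>s\<close> is the maximum of the memory sizes during the run.
\<close>

inductive exec :: "query_oracle \<Rightarrow> prog \<Rightarrow> mem \<Rightarrow> nat \<Rightarrow> nat \<Rightarrow> mem \<Rightarrow> bool" for Q where
  Skip: "exec Q SKIP M 1 (mem_size M) M"
| Instr: "M' = M(target i M := result Q i M) \<Longrightarrow>
    exec Q (INSTR i) M (instr_cost Q i M) (max (mem_size M) (mem_size M')) M'"
| Seq: "exec Q p M t\<^sub>1 s\<^sub>1 M' \<Longrightarrow> exec Q q M' t\<^sub>2 s\<^sub>2 M'' \<Longrightarrow>
    exec Q (SEQ p q) M (t\<^sub>1 + t\<^sub>2) (max s\<^sub>1 s\<^sub>2) M''"
| IfTrue: "M a \<noteq> 0 \<Longrightarrow> exec Q p M t s M' \<Longrightarrow>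
    exec Q (IFNZ a p q) M (1 + cell_cost a (M a) + t) s M'"
| IfFalse: "M a = 0 \<Longrightarrow> exec Q q M t s M' \<Longrightarrow>
    exec Q (IFNZ a p q) M (1 + cell_cost a (M a) + t) s M'"
| WhileFalse: "M a = 0 \<Longrightarrow>
    exec Q (WHILENZ a p) M (1 + cell_cost a (M a)) (mem_size M) M"
| WhileTrue: "M a \<noteq> 0 \<Longrightarrow> exec Q p M t\<^sub>1 s\<^sub>1 M' \<Longrightarrow> exec Q (WHILENZ a p) M' t\<^sub>2 s\<^sub>2 M'' \<Longrightarrow>
    exec Q (WHILENZ a p) M (1 + cell_cost a (M a) + t\<^sub>1 + t\<^sub>2) (max s\<^sub>1 s\<^sub>2) M''"

definition input_mem :: "nat \<Rightarrow> nat \<Rightarrow> nat \<Rightarrow> mem" where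
  "input_mem n v T = (\<lambda>_. 0)(0 := n, 1 := v, 2 := T)"

text \<open>The output is the rational number with numerator in cell \<open>0\<close> and denominator in cell \<open>1\<close>.\<close>

definition returned :: "mem \<Rightarrow> real" where
  "returned M = real (M 0) / real (M 1)"

text \<open>The logarithm whose powers are absorbed by the soft-O notation; it is at least \<open>1\<close>.\<close>

definition soft_log :: "nat \<Rightarrow> nat \<Rightarrow> nat \<Rightarrow> real \<Rightarrow> real" where
  "soft_log n m T \<delta> = log 2 (2 + real n + real m + real T + 1 / \<delta>)"

end

theory Submission
  imports Defs
begin

text \<open>
  The algorithm is a power iteration in fixed-point arithmetic, started from the point mass at the
  queried vertex \<open>v\<close>, which is scaled by an integer \<open>D\<close>. A step divides the mass of each vertex by
  its out-degree, rounds down, and sends the quotient along each outgoing arc. It never overestimates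
  the exact walk and loses mass at most \<open>m\<close> in total, so after \<open>T\<close> steps every entry is off by at
  most \<open>T m\<close>. With \<open>D = K T m\<close>, where \<open>K\<close> is a power of \<open>2\<close> with \<open>1 / \<delta> \<le> K\<close>, this is a relative
  error of at most \<open>\<delta>\<close>, and all numbers have logarithmic length. If \<open>1 \<le> \<delta>\<close> or \<open>T = 0\<close>, or if
  some vertex has no outgoing arc, then \<open>1\<close> is a valid answer. The search for such a vertex stops at
  the first one, after at most \<open>m + 1\<close> queries, which keeps the time bound valid even for \<open>m < n\<close>.
\<close>

section \<open>Step counting on a machine with bounded memory\<close>

lemma bits_mono: "x \<le> y \<Longrightarrow> bits x \<le> bits y"
  unfolding bits_def by (meson floorlog_mono max.mono order_refl)

lemma bits_pos: "1 \<le> bits x"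
  unfolding bits_def by simp

lemma cell_cost_le: "a \<le> B \<Longrightarrow> x \<le> B \<Longrightarrow> cell_cost a x \<le> 2 * bits B"
  unfolding cell_cost_def using bits_mono[of a B] bits_mono[of x B] by linarith

definition step :: "query_oracle \<Rightarrow> instr \<Rightarrow> mem \<Rightarrow> mem" where
  "step Q i M = M(target i M := result Q i M)"

text \<open>The closing \<open>SKIP\<close> takes one step of its own; it is the \<open>+ 1\<close>
  in \<open>runs_block\<close>.\<close>

definition block :: "instr list \<Rightarrow> prog" where
  "block is = foldr (\<lambda>i. SEQ (INSTR i)) is SKIP"

text \<open>\<open>A\<close> limits the addresses of nonzero cells and so governs space;
  \<open>B\<close> limits contents and enters only through its bit length. Keeping them apart makes
  space linear in \<open>n\<close> up to logarithms although contents grow with \<open>m\<close>,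
  \<open>T\<close> and \<open>1 / \<delta>\<close>.\<close>

locale bounded_machine =
  fixes Q :: query_oracle and B A :: nat
  assumes A_le_B: "A \<le> B"
begin

definition good :: "mem \<Rightarrow> bool" where
  "good M \<longleftrightarrow> (\<forall>a. M a \<le> B) \<and> (\<forall>a\<ge>A. M a = 0)"

text \<open>
  Since every instruction touches at most three cells, a run whose addresses and contents never
  exceed \<open>B\<close> costs at most \<open>7 * bits B\<close> per step; \<open>k\<close> counts steps.
\<close>

definition runs :: "prog \<Rightarrow> nat \<Rightarrow> mem \<Rightarrow> (mem \<Rightarrow> bool) \<Rightarrow> bool" where
  "runs p k M R \<longleftrightarrow> (\<exists>t s M'. exec Q p M t s M' \<and> t \<le> k * (7 * bits B) \<and>
     s \<le> A * (2 * bits B) \<and> good M' \<and> R M')"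

text \<open>Evaluated along the run, so that for a concrete block simplification leaves plain
  inequalities. Writes must stay below \<open>A\<close>, whereas a read is merely charged for its
  address, for which \<open>B\<close> suffices.\<close>

fun ok :: "instr list \<Rightarrow> mem \<Rightarrow> bool" where
  "ok [] M \<longleftrightarrow> True"
| "ok (i # is) M \<longleftrightarrow> (\<forall>a\<in>set (cells_read i M). a \<le> B) \<and> target i M < A \<and> result Q i M \<le> B \<and>
     ok is (step Q i M)"

lemma good_le: "good M \<Longrightarrow> M a \<le> B"
  by (simp add: good_def)

lemma mem_size_le:
  assumes "good M"
  shows "mem_size M \<le> A * (2 * bits B)"
proof -
  have sub: "{a. M a \<noteq> 0} \<subseteq> {..<A}"
    using assms by (auto simp: good_def not_less[symmetric])
  have "mem_size M \<le> (\<Sum>a\<in>{a. M a \<noteq> 0}. 2 * bits B)"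
    unfolding mem_size_def using assms sub A_le_B
    by (intro sum_mono cell_cost_le) (auto simp: good_def intro: less_imp_le order_trans)
  also have "\<dots> \<le> (\<Sum>a\<in>{..<A}. 2 * bits B)"
    using sub by (intro sum_mono2) auto
  finally show ?thesis by simp
qed

lemma good_step:
  "good M \<Longrightarrow> target i M < A \<Longrightarrow> result Q i M \<le> B \<Longrightarrow> good (step Q i M)"
  by (auto simp: good_def step_def)

lemma instr_cost_le:
  assumes M: "good M" and r: "\<forall>a\<in>set (cells_read i M). a \<le> B"
    and t: "target i M < A" and v: "result Q i M \<le> B"
  shows "instr_cost Q i M \<le> 7 * bits B"
proof -
  have "(\<Sum>a\<leftarrow>cells_read i M. cell_cost a (M a)) \<le> (\<Sum>a\<leftarrow>cells_read i M. 2 * bits B)"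
    using r M by (intro sum_list_mono cell_cost_le) (auto simp: good_def)
  also have "\<dots> \<le> 2 * (2 * bits B)"
    by (cases i) auto
  finally have "(\<Sum>a\<leftarrow>cells_read i M. cell_cost a (M a)) \<le> 4 * bits B" by simp
  moreover have "cell_cost (target i M) (result Q i M) \<le> 2 * bits B"
    using t v A_le_B by (intro cell_cost_le) auto
  \<comment> \<open>Two reads and one write cost at most \<open>6 * bits B\<close>; the seventh
    share absorbs the additive \<open>1\<close>.\<close>
  ultimately show ?thesis unfolding instr_cost_def using bits_pos[of B] by linarith
qed

section \<open>Composition rules for bounded runs\<close>

lemma runs_weaken:
  assumes "runs p k M R" "k \<le> k'" "\<And>M'. good M' \<Longrightarrow> R M' \<Longrightarrow> R' M'"
  shows "runs p k' M R'"
proof -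
  have "k * (7 * bits B) \<le> k' * (7 * bits B)"
    using assms(2) by (intro mult_le_mono) auto
  then show ?thesis using assms(1,3) unfolding runs_def by (meson order_trans)
qed

lemma runs_seq:
  assumes "runs p k M S" "\<And>M'. good M' \<Longrightarrow> S M' \<Longrightarrow> runs q k' M' R"
  shows "runs (SEQ p q) (k + k') M R"
proof -
  obtain t s M' where 1: "exec Q p M t s M'" "t \<le> k * (7 * bits B)" "s \<le> A * (2 * bits B)"
      "good M'" "S M'"
    using assms(1) unfolding runs_def by blast
  obtain t' s' M'' where 2: "exec Q q M' t' s' M''" "t' \<le> k' * (7 * bits B)"
      "s' \<le> A * (2 * bits B)" "good M''" "R M''"
    using assms(2)[OF 1(4,5)] unfolding runs_def by blast
  have "exec Q (SEQ p q) M (t + t') (max s s') M''"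
    using 1(1) 2(1) by (rule exec.Seq)
  moreover have "t + t' \<le> (k + k') * (7 * bits B)"
    using 1(2) 2(2) by (simp add: add_mult_distrib)
  ultimately show ?thesis using 1(3) 2(3,4,5) unfolding runs_def by (metis max.bounded_iff)
qed

lemma runs_skip:
  assumes "good M" "R M"
  shows "runs SKIP 1 M R"
proof -
  have "1 \<le> 1 * (7 * bits B)" using bits_pos[of B] by simp
  then show ?thesis unfolding runs_def using assms exec.Skip mem_size_le by blast
qed

lemma runs_instr:
  assumes "good M" "ok [i] M" "R (step Q i M)"
  shows "runs (INSTR i) 1 M R"
proof -
  have "good (step Q i M)" using assms by (simp add: good_step)
  moreover have "instr_cost Q i M \<le> 1 * (7 * bits B)"
    using assms instr_cost_le[of M i] by simp
  moreover have "exec Q (INSTR i) M (instr_cost Q i M)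
      (max (mem_size M) (mem_size (step Q i M))) (step Q i M)"
    by (rule exec.Instr) (simp add: step_def)
  ultimately show ?thesis using assms mem_size_le unfolding runs_def
    by (metis max.bounded_iff)
qed

lemma runs_block:
  assumes "good M" "ok is M" "R (fold (step Q) is M)"
  shows "runs (block is) (length is + 1) M R"
  using assms
proof (induction "is" arbitrary: M)
  case Nil
  then show ?case using runs_skip by (simp add: block_def)
next
  case (Cons i "is")
  have "runs (INSTR i) 1 M ((=) (step Q i M))"
    using Cons.prems by (intro runs_instr) auto
  then have "runs (SEQ (INSTR i) (block is)) (1 + (length is + 1)) M R"
    by (rule runs_seq) (use Cons in auto)
  then show ?case by (simp add: block_def)
qed

lemma runs_block_le:
  assumes "good M" "ok is M" "R (fold (step Q) is M)" "length is < k"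
  shows "runs (block is) k M R"
  by (rule runs_weaken[OF runs_block]) (use assms in auto)

lemma branch_cost_le:
  assumes "good M" "a < A"
  shows "1 + cell_cost a (M a) \<le> 7 * bits B"
  using cell_cost_le[of a B "M a"] assms A_le_B bits_pos[of B] good_le[of M a] by simp

lemma runs_ifnz:
  assumes M: "good M" and a: "a < A"
    and p: "M a \<noteq> 0 \<Longrightarrow> runs p k M R" and q: "M a = 0 \<Longrightarrow> runs q k M R"
  shows "runs (IFNZ a p q) (k + 1) M R"
proof -
  define r where "r = (if M a = 0 then q else p)"
  have "runs r k M R" using p q by (auto simp: r_def)
  then obtain t s M' where 1: "exec Q r M t s M'" "t \<le> k * (7 * bits B)" "s \<le> A * (2 * bits B)"
      "good M'" "R M'"
    unfolding runs_def by blast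
  have "exec Q (IFNZ a p q) M (1 + cell_cost a (M a) + t) s M'"
    using 1(1) exec.IfTrue[of M a Q p] exec.IfFalse[of M a Q q] unfolding r_def
    by (auto split: if_splits)
  moreover have "1 + cell_cost a (M a) + t \<le> (k + 1) * (7 * bits B)"
    using branch_cost_le[OF M a] 1(2) by simp
  ultimately show ?thesis unfolding runs_def using 1 by blast
qed

text \<open>Amortised analysis: \<open>k\<close> may vary from round to round, and the drop of the
  potential \<Phi> pays for the body and one loop test. The final failing test is the
  \<open>+ 1\<close> in the conclusion.\<close>

lemma runs_while:
  assumes a: "a < A"
    and body: "\<And>M. good M \<Longrightarrow> I M \<Longrightarrow> M a \<noteq> 0 \<Longrightarrow>
      \<exists>k. runs p k M (\<lambda>M'. I M' \<and> \<Phi> M' + k + 1 \<le> \<Phi> M)"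
    and "good M" "I M"
  shows "runs (WHILENZ a p) (\<Phi> M + 1) M (\<lambda>M'. I M' \<and> M' a = 0)"
  using assms(3,4)
proof (induction "\<Phi> M" arbitrary: M rule: less_induct)
  case less
  show ?case
  proof (cases "M a = 0")
    case True
    have "1 + cell_cost a (M a) \<le> (\<Phi> M + 1) * (7 * bits B)"
      using branch_cost_le[OF less.prems(1) a] by simp
    then show ?thesis unfolding runs_def
      using exec.WhileFalse[of M a Q p] True less.prems mem_size_le[of M] by blast
  next
    case False
    obtain k where "runs p k M (\<lambda>M'. I M' \<and> \<Phi> M' + k + 1 \<le> \<Phi> M)"
      using body[OF less.prems False] by blast
    then obtain t s M' where 1: "exec Q p M t s M'" "t \<le> k * (7 * bits B)"
        "s \<le> A * (2 * bits B)" "good M'" "I M'" "\<Phi> M' + k + 1 \<le> \<Phi> M"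
      unfolding runs_def by blast
    have "runs (WHILENZ a p) (\<Phi> M' + 1) M' (\<lambda>M'. I M' \<and> M' a = 0)"
      using 1 by (intro less.hyps) auto
    then obtain t' s' M'' where 2: "exec Q (WHILENZ a p) M' t' s' M''"
        "t' \<le> (\<Phi> M' + 1) * (7 * bits B)" "s' \<le> A * (2 * bits B)" "good M''" "I M''" "M'' a = 0"
      unfolding runs_def by blast
    have run: "exec Q (WHILENZ a p) M (1 + cell_cost a (M a) + t + t') (max s s') M''"
      using False 1(1) 2(1) by (rule exec.WhileTrue)
    have "1 + cell_cost a (M a) + t + t' \<le> (1 + k + (\<Phi> M' + 1)) * (7 * bits B)"
      using branch_cost_le[OF less.prems(1) a] 1(2) 2(2) by (simp add: algebra_simps)
    also have "\<dots> \<le> (\<Phi> M + 1) * (7 * bits B)"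
      using 1(6) by (intro mult_le_mono) auto
    finally have "1 + cell_cost a (M a) + t + t' \<le> (\<Phi> M + 1) * (7 * bits B)" .
    moreover have "max s s' \<le> A * (2 * bits B)" using 1(3) 2(3) by simp
    ultimately show ?thesis unfolding runs_def using run 2(4-6) by blast
  qed
qed

end

section \<open>Rounded power iteration\<close>

text \<open>Mass is collected along incoming arcs, so that in the program each new entry is a single
  running sum; summing over arcs counts parallel arcs with multiplicity. The type \<open>mem\<close>
  stands here just for functions on the naturals.\<close>

definition next_mass :: "graph \<Rightarrow> mem \<Rightarrow> mem" where
  "next_mass G x w = (\<Sum>e\<in>in_arcs G w. x (tail G e) div out_degree G (tail G e))"

primrec mass :: "graph \<Rightarrow> nat \<Rightarrow> nat \<Rightarrow> nat \<Rightarrow> mem" where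
  "mass G D v 0 = (\<lambda>u. if u = v then D else 0)"
| "mass G D v (Suc t) = next_mass G (mass G D v t)"

abbreviation walk_dist :: "graph \<Rightarrow> nat \<Rightarrow> nat \<Rightarrow> nat \<Rightarrow> real vec" where
  "walk_dist G n v t \<equiv> random_walk_mat G ^\<^sub>m t *\<^sub>v unit_vec n v"

text \<open>Powers multiply on the right by definition, while a step of the walk applies the matrix
  on the left.\<close>

lemma pow_mat_Suc_left:
  fixes W :: "'a :: semiring_1 mat"
  assumes "W \<in> carrier_mat n n"
  shows "W ^\<^sub>m Suc t = W * W ^\<^sub>m t"
proof (induction t)
  case (Suc t)
  then have "W ^\<^sub>m Suc (Suc t) = (W * W ^\<^sub>m t) * W" by simp
  also have "\<dots> = W * W ^\<^sub>m Suc t"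
    using assms by (simp add: assoc_mult_mat[of W n n _ n W n])
  finally show ?case .
qed (use assms in auto)

lemma abs_diff_le_l1_norm:
  assumes "x \<in> carrier_vec n" "y \<in> carrier_vec n" "i < n"
  shows "\<bar>x $ i - y $ i\<bar> \<le> l1_norm (x - y)"
proof -
  have "\<bar>x $ i - y $ i\<bar> = \<bar>(x - y) $ i\<bar>" using assms by simp
  also have "\<dots> \<le> (\<Sum>i<n. \<bar>(x - y) $ i\<bar>)"
    using assms(3) by (intro member_le_sum) auto
  finally show ?thesis using assms by (simp add: l1_norm_def)
qed

lemma prob_vec_unit: "v < n \<Longrightarrow> prob_vec n (unit_vec n v)"
  by (auto simp: prob_vec_def unit_vec_def sum.delta)

lemma prob_vec_le_1:
  assumes "prob_vec n x" "i < n"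
  shows "x $ i \<le> 1"
proof -
  have "x $ i \<le> (\<Sum>j<n. x $ j)"
    using assms by (intro member_le_sum) (auto simp: prob_vec_def)
  then show ?thesis using assms by (simp add: prob_vec_def)
qed

section \<open>Counting arcs by head and by tail\<close>

locale walk_graph =
  fixes G :: graph and n m :: nat
  assumes graph_on: "graph_on n G" and card_arcs: "m = card (arcs G)"
begin

lemma fin: "fin_digraph G" and verts: "verts G = {..<n}"
  using graph_on by (auto simp: graph_on_def)

lemma wf: "e \<in> arcs G \<Longrightarrow> tail G e < n" "e \<in> arcs G \<Longrightarrow> head G e < n"
proof -
  have "wf_digraph G" using fin by (simp add: fin_digraph_def)
  then show "e \<in> arcs G \<Longrightarrow> tail G e < n" "e \<in> arcs G \<Longrightarrow> head G e < n"
    using wf_digraph.tail_in_verts[of G e] wf_digraph.head_in_verts[of G e] verts by auto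
qed

lemma finite_arcs: "finite (arcs G)"
  using fin fin_digraph.finite_arcs by blast

lemma sum_in_arcs:
  fixes f :: "nat \<Rightarrow> 'a :: comm_monoid_add"
  shows "(\<Sum>w<n. \<Sum>e\<in>in_arcs G w. f e) = (\<Sum>e\<in>arcs G. f e)"
  unfolding in_arcs_def by (rule sum.group) (use finite_arcs wf in auto)

lemma sum_out_arcs:
  fixes f :: "nat \<Rightarrow> 'a :: comm_monoid_add"
  shows "(\<Sum>w<n. \<Sum>e\<in>out_arcs G w. f e) = (\<Sum>e\<in>arcs G. f e)"
  unfolding out_arcs_def by (rule sum.group) (use finite_arcs wf in auto)

text \<open>Double counting: both sides sum \<open>f (tail G e)\<close> over all arcs, grouped by
  heads on the left and by tails on the right. This is the conservation law behind both the rounded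
  and the exact walk.\<close>

lemma sum_tail:
  fixes f :: "nat \<Rightarrow> 'a :: semiring_1"
  shows "(\<Sum>w<n. \<Sum>e\<in>in_arcs G w. f (tail G e)) = (\<Sum>u<n. of_nat (out_degree G u) * f u)"
proof -
  have "(\<Sum>u<n. of_nat (out_degree G u) * f u) = (\<Sum>u<n. \<Sum>e\<in>out_arcs G u. f (tail G e))"
    by (intro sum.cong) (auto simp: out_degree_def)
  also have "\<dots> = (\<Sum>w<n. \<Sum>e\<in>in_arcs G w. f (tail G e))"
    unfolding sum_in_arcs sum_out_arcs ..
  finally show ?thesis ..
qed

lemma sum_in_degree: "(\<Sum>u<n. in_degree G u) = m"
  using sum_in_arcs[of "\<lambda>_. 1 :: nat"] by (simp add: in_degree_def card_arcs)

lemma sum_out_degree: "(\<Sum>u<n. out_degree G u) = m"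
  using sum_out_arcs[of "\<lambda>_. 1 :: nat"] by (simp add: out_degree_def card_arcs)

lemma in_degree_le: "in_degree G u \<le> m"
  unfolding in_degree_def in_arcs_def card_arcs
  by (rule card_mono[OF finite_arcs]) auto

lemma out_degree_le: "out_degree G u \<le> m"
  unfolding out_degree_def out_arcs_def card_arcs
  by (rule card_mono[OF finite_arcs]) auto

text \<open>Each vertex owns at least one outgoing arc. This absorbs the \<open>n * T\<close> cost
  of visiting all vertices in every round into \<open>m * T\<close>.\<close>

lemma n_le_m:
  assumes "\<forall>u<n. out_degree G u \<noteq> 0"
  shows "n \<le> m"
proof -
  have "(\<Sum>u<n. 1) \<le> (\<Sum>u<n. out_degree G u)"
    using assms by (intro sum_mono) (simp add: Suc_le_eq)
  then show ?thesis by (simp add: sum_out_degree)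
qed

section \<open>Mass balance of the rounded walk\<close>

lemma sum_next_mass: "(\<Sum>w<n. next_mass G x w) = (\<Sum>u<n. out_degree G u * (x u div out_degree G u))"
  unfolding next_mass_def using sum_tail[of "\<lambda>u. x u div out_degree G u"] by simp

lemma sum_next_mass_le: "(\<Sum>w<n. next_mass G x w) \<le> (\<Sum>u<n. x u)"
  unfolding sum_next_mass by (intro sum_mono) simp

text \<open>A vertex loses the remainder of a division by its out-degree, which is less than the
  out-degree, and the out-degrees sum to \<open>m\<close>.\<close>

lemma sum_next_mass_ge:
  assumes "\<forall>u<n. out_degree G u \<noteq> 0"
  shows "(\<Sum>u<n. x u) \<le> (\<Sum>w<n. next_mass G x w) + m"
proof -
  have "x u \<le> out_degree G u * (x u div out_degree G u) + out_degree G u" if "u < n" for u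
  proof -
    have "x u mod out_degree G u < out_degree G u" using assms that by simp
    then show ?thesis using mult_div_mod_eq[of "out_degree G u" "x u"] by linarith
  qed
  then have "(\<Sum>u<n. x u) \<le> (\<Sum>u<n. out_degree G u * (x u div out_degree G u) + out_degree G u)"
    by (intro sum_mono) auto
  then show ?thesis by (simp add: sum.distrib sum_out_degree sum_next_mass)
qed

lemma sum_mass_le: "(\<Sum>u<n. mass G D v t u) \<le> D"
proof (induction t)
  case (Suc t)
  then show ?case using sum_next_mass_le[of "mass G D v t"] by simp
qed simp

text \<open>Keeps the stored masses within the bound on cell contents.\<close>

lemma mass_le:
  assumes "u < n"
  shows "mass G D v t u \<le> D"
proof -
  have "mass G D v t u \<le> (\<Sum>u<n. mass G D v t u)"
    using assms by (intro member_le_sum) auto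
  then show ?thesis using sum_mass_le[of D v t] by simp
qed

lemma sum_mass_ge:
  assumes "\<forall>u<n. out_degree G u \<noteq> 0" "v < n"
  shows "D \<le> (\<Sum>u<n. mass G D v t u) + t * m"
proof (induction t)
  case (Suc t)
  then show ?case using sum_next_mass_ge[OF assms(1), of "mass G D v t"] by simp
qed (use assms in \<open>simp add: sum.delta\<close>)

section \<open>The exact walk and the rounding error\<close>

lemma random_walk_mat_carrier: "random_walk_mat G \<in> carrier_mat n n"
  by (simp add: random_walk_mat_def verts)

lemma walk_dist_carrier: "walk_dist G n v t \<in> carrier_vec n"
  using random_walk_mat_carrier by (intro mult_mat_vec_carrier[of _ n n]) auto

text \<open>Grouping the arcs into \<open>w\<close> by tail turns the arc counts in the matrix into
  a sum over single arcs, which is \<open>next_mass\<close> without the rounding.\<close>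

lemma random_walk_step:
  assumes x: "x \<in> carrier_vec n" and w: "w < n"
  shows "(random_walk_mat G *\<^sub>v x) $ w =
    (\<Sum>e\<in>in_arcs G w. x $ tail G e / real (out_degree G (tail G e)))"
proof -
  let ?f = "\<lambda>u. x $ u / real (out_degree G u)"
  have "(random_walk_mat G *\<^sub>v x) $ w =
      (\<Sum>u<n. real (num_arcs_betw G u w) / real (out_degree G u) * x $ u)"
    using x w by (simp add: random_walk_mat_def verts scalar_prod_def lessThan_atLeast0)
  also have "\<dots> = (\<Sum>u<n. \<Sum>e\<in>{e \<in> in_arcs G w. tail G e = u}. ?f (tail G e))"
    by (intro sum.cong) (auto simp: num_arcs_betw_def in_arcs_def conj_ac)
  also have "\<dots> = (\<Sum>e\<in>in_arcs G w. ?f (tail G e))"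
    by (rule sum.group) (use finite_arcs wf in \<open>auto simp: in_arcs_def\<close>)
  finally show ?thesis .
qed

lemma walk_dist_Suc:
  "walk_dist G n v (Suc t) = random_walk_mat G *\<^sub>v walk_dist G n v t"
  unfolding pow_mat_Suc_left[OF random_walk_mat_carrier]
  by (rule assoc_mult_mat_vec[of _ n n _ n]) (use random_walk_mat_carrier in auto)

lemma sum_walk_dist:
  assumes "\<forall>u<n. out_degree G u \<noteq> 0" "v < n"
  shows "(\<Sum>u<n. walk_dist G n v t $ u) = 1"
proof (induction t)
  case 0
  then show ?case
    using prob_vec_unit[OF assms(2)] random_walk_mat_carrier by (simp add: prob_vec_def)
next
  case (Suc t)
  have "(\<Sum>u<n. walk_dist G n v (Suc t) $ u) =
      (\<Sum>w<n. \<Sum>e\<in>in_arcs G w. walk_dist G n v t $ tail G e / real (out_degree G (tail G e)))"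
    unfolding walk_dist_Suc using random_walk_step[OF walk_dist_carrier] by simp
  also have "\<dots> = (\<Sum>u<n. real (out_degree G u) * (walk_dist G n v t $ u / real (out_degree G u)))"
    by (rule sum_tail)
  also have "\<dots> = (\<Sum>u<n. walk_dist G n v t $ u)"
    using assms(1) by (intro sum.cong) auto
  finally show ?case using Suc by simp
qed

text \<open>Rounding down only loses mass and a step is monotone in the masses, so the inequality
  survives each step.\<close>

lemma mass_le_walk_dist:
  assumes "v < n" "w < n"
  shows "real (mass G D v t w) \<le> real D * walk_dist G n v t $ w"
  using assms(2)
proof (induction t arbitrary: w)
  case 0
  then show ?case using random_walk_mat_carrier assms(1) by (auto simp: unit_vec_def)
next
  case (Suc t)
  let ?d = "\<lambda>e. out_degree G (tail G e)"
  have "real (mass G D v (Suc t) w) = (\<Sum>e\<in>in_arcs G w. real (mass G D v t (tail G e) div ?d e))"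
    by (simp add: next_mass_def)
  also have "\<dots> \<le> (\<Sum>e\<in>in_arcs G w. real D * walk_dist G n v t $ tail G e / real (?d e))"
  proof (rule sum_mono)
    fix e assume "e \<in> in_arcs G w"
    then have "real (mass G D v t (tail G e)) \<le> real D * walk_dist G n v t $ tail G e"
      using Suc.IH wf by simp
    then show "real (mass G D v t (tail G e) div ?d e)
        \<le> real D * walk_dist G n v t $ tail G e / real (?d e)"
      by (rule order_trans[OF of_nat_div_le_of_nat divide_right_mono]) auto
  qed
  also have "\<dots> = real D * walk_dist G n v (Suc t) $ w"
    unfolding walk_dist_Suc
    using Suc.prems by (simp add: random_walk_step[OF walk_dist_carrier] sum_distrib_left)
  finally show ?case .
qed

text \<open>The gaps to the exact walk are nonnegative, so a single gap is at most their sum, and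
  that sum is the total mass lost so far.\<close>

lemma mass_error:
  assumes d: "\<forall>u<n. out_degree G u \<noteq> 0" and v: "v < n" and w: "w < n" and D: "0 < D"
  shows "\<bar>real (mass G D v t w) / real D - walk_dist G n v t $ w\<bar> \<le> real t * real m / real D"
proof -
  define g where "g u = real D * walk_dist G n v t $ u - real (mass G D v t u)" for u
  have g: "g u \<ge> 0" if "u < n" for u
    using mass_le_walk_dist[OF v that] by (simp add: g_def)
  have "g w \<le> (\<Sum>u<n. g u)"
    using g w by (intro member_le_sum) auto
  also have "\<dots> = real D - real (\<Sum>u<n. mass G D v t u)"
    using sum_walk_dist[OF d v] by (simp add: g_def sum_subtractf sum_distrib_left[symmetric])
  also have "\<dots> \<le> real t * real m"
    using of_nat_mono[OF sum_mass_ge[OF d v, of D t], where 'a = real] by simp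
  finally have "g w / real D \<le> real t * real m / real D"
    by (rule divide_right_mono) simp
  moreover have "walk_dist G n v t $ w - real (mass G D v t w) / real D = g w / real D"
    using D by (simp add: g_def field_simps)
  ultimately show ?thesis using g[OF w] by (simp add: abs_minus_commute)
qed

section \<open>From the walk to the stationary distribution\<close>

lemma stationary_out_degree:
  assumes "stationary_distribution (random_walk_mat G) \<pi>" "u < n"
  shows "out_degree G u \<noteq> 0"
proof
  \<comment> \<open>The column of such a vertex is zero, while stochasticity is part of
    \<open>stationary_distribution\<close>.\<close>
  assume "out_degree G u = 0"
  then have "(\<Sum>w<n. col (random_walk_mat G) u $ w) = 0"
    using assms(2) by (simp add: random_walk_mat_def verts)
  moreover have "prob_vec n (col (random_walk_mat G) u)"
    using assms random_walk_mat_carrier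
    by (auto simp: stationary_distribution_def stochastic_mat_def)
  ultimately show False by (simp add: prob_vec_def)
qed

text \<open>Mixing is applied to the point mass at \<open>v\<close>; uniqueness identifies the
  vector inside \<open>mixes\<close> with \<pi>, and one coordinate is bounded by the norm.\<close>

lemma walk_dist_near_stationary:
  assumes "stationary_distribution (random_walk_mat G) \<pi>" "mixes (random_walk_mat G) T \<epsilon>" "v < n"
  shows "\<bar>walk_dist G n v T $ v - \<pi> $ v\<bar> \<le> \<epsilon>"
proof -
  have "l1_norm (walk_dist G n v T - \<pi>) \<le> \<epsilon>"
  proof -
    obtain \<pi>' where \<pi>': "\<forall>\<pi>. stationary_distribution (random_walk_mat G) \<pi> \<longrightarrow> \<pi> = \<pi>'"
      "\<forall>x. prob_vec (dim_row (random_walk_mat G)) x \<longrightarrow>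
        l1_norm (random_walk_mat G ^\<^sub>m T *\<^sub>v x - \<pi>') \<le> \<epsilon>"
      using assms(2) unfolding mixes_def by blast
    then show ?thesis
      using assms(1) prob_vec_unit[OF assms(3)] carrier_matD(1)[OF random_walk_mat_carrier] by simp
  qed
  moreover have "\<pi> \<in> carrier_vec n"
    using assms(1) random_walk_mat_carrier
    by (auto simp: stationary_distribution_def prob_vec_def)
  ultimately show ?thesis
    using abs_diff_le_l1_norm[OF walk_dist_carrier _ assms(3)] by (meson order_trans)
qed

lemma trivial_estimate:
  assumes \<pi>: "stationary_distribution (random_walk_mat G) \<pi>"
    and mix: "mixes (random_walk_mat G) T \<epsilon>" and v: "v < n" and \<delta>: "0 < \<delta>"
    and triv: "1 \<le> \<delta> \<or> T = 0 \<or> (\<exists>u<n. out_degree G u = 0)"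
  shows "\<bar>1 - \<pi> $ v\<bar> \<le> \<epsilon> + \<delta>"
proof -
  have near: "\<bar>walk_dist G n v T $ v - \<pi> $ v\<bar> \<le> \<epsilon>"
    using \<pi> mix v by (rule walk_dist_near_stationary)
  consider "1 \<le> \<delta>" | "T = 0" using triv stationary_out_degree[OF \<pi>] by blast
  then show ?thesis
  proof cases
    case 1
    have "prob_vec n \<pi>" using \<pi> random_walk_mat_carrier
      by (auto simp: stationary_distribution_def)
    then have "0 \<le> \<pi> $ v" "\<pi> $ v \<le> 1" using v prob_vec_le_1 by (auto simp: prob_vec_def)
    \<comment> \<open>Here \<open>near\<close> contributes only that \<epsilon> is
      nonnegative.\<close>
    then show ?thesis using near 1 by linarith
  next
    case 2
    \<comment> \<open>After zero steps the walk is still at \<open>v\<close>, so the answer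
      \<open>1\<close> is its exact probability.\<close>
    then have "walk_dist G n v T $ v = 1" using v random_walk_mat_carrier by simp
    then show ?thesis using near \<delta> by simp
  qed
qed

lemma scaled_estimate:
  assumes \<pi>: "stationary_distribution (random_walk_mat G) \<pi>"
    and mix: "mixes (random_walk_mat G) T \<epsilon>" and v: "v < n"
    and D: "D = K * (m * T)" "0 < D" and K: "1 \<le> \<delta> * real K"
  shows "\<bar>real (mass G D v T v) / real D - \<pi> $ v\<bar> \<le> \<epsilon> + \<delta>"
proof -
  have "\<bar>real (mass G D v T v) / real D - walk_dist G n v T $ v\<bar> \<le> real T * real m / real D"
    using stationary_out_degree[OF \<pi>] v v D(2) by (intro mass_error) auto
  also have "\<dots> = 1 / real K"
    using D by auto
  also have "\<dots> \<le> \<delta>"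
    using K D(1,2) by (simp add: field_simps)
  finally show ?thesis
    using walk_dist_near_stationary[OF \<pi> mix v] by linarith
qed

end

section \<open>The program\<close>

text \<open>
  Cells \<open>0\<close>, \<open>1\<close>, \<open>2\<close> hold \<open>n\<close>, \<open>v\<close> and the number of remaining rounds; \<open>3\<close> and \<open>4\<close> the base
  addresses \<open>20\<close> and \<open>20 + n\<close> of the current and the next mass vector; \<open>5\<close> the constant \<open>1\<close>;
  \<open>6\<close> a flag; \<open>7\<close> and \<open>12\<close> counters running downwards; \<open>8\<close> first \<open>m\<close> and then \<open>m T\<close>; \<open>10\<close> first
  \<open>K\<close> and then \<open>D\<close>. The others are scratch.
\<close>

definition gather :: prog where
  "gather = WHILENZ 12 (block
    [SUB 12 12 5, INNBR 13 7 12, ADD 9 3 13, LOAD 14 9, OUTDEG 15 13, DIV 14 14 15, ADD 11 11 14])"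

definition sweep :: prog where
  "sweep = WHILENZ 7 (SEQ (block [SUB 7 7 5, INDEG 12 7, SET 11 0])
    (SEQ gather (block [ADD 9 4 7, STORE 9 11])))"

text \<open>Copying instead of swapping the two vectors keeps the base addresses fixed.\<close>

definition copy_back :: prog where
  "copy_back = WHILENZ 7 (block [SUB 7 7 5, ADD 9 4 7, LOAD 14 9, ADD 9 3 7, STORE 9 14])"

definition rounds :: prog where
  "rounds = WHILENZ 2 (SEQ (block [COPY 7 0]) (SEQ sweep
    (SEQ (block [COPY 7 0]) (SEQ copy_back (block [SUB 2 2 5])))))"

text \<open>\<open>SUB 9 5 9\<close> negates the oracle's answer, as the loop runs while cell
  \<open>9\<close> is nonzero. \<open>K = 1\<close> is not tested: this code is reached only if
  \<open>1 \<le> \<delta>\<close> fails.\<close>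

definition doubling :: prog where
  "doubling = SEQ (block [SET 10 1, SET 9 1])
    (WHILENZ 9 (block [ADD 10 10 10, DELTA 9 5 10, SUB 9 5 9]))"

text \<open>A single \<open>STORE\<close> sets up the point mass, since the cells from
  \<open>20\<close> on are still zero.\<close>

definition power_iteration :: prog where
  "power_iteration = SEQ doubling (SEQ
    (block [MUL 8 8 2, MUL 10 10 8, SET 3 20, ADD 4 3 0, ADD 9 3 1, STORE 9 10])
    (SEQ rounds (block [ADD 9 3 1, LOAD 0 9, COPY 1 10])))"

text \<open>The input does not contain \<open>m\<close>; it is obtained here as the sum of the
  out-degrees. Clearing the counter leaves the loop early.\<close>

definition scan_degrees :: prog where
  "scan_degrees = SEQ (block [COPY 7 0]) (WHILENZ 7 (SEQ (block [SUB 7 7 5, OUTDEG 9 7])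
    (IFNZ 9 (block [ADD 8 8 9]) (block [SET 6 1, SET 7 0]))))"

definition return_one :: prog where
  "return_one = block [SET 0 1, SET 1 1]"

text \<open>\<open>DELTA 6 5 5\<close> asks whether \<open>1 \<le> \<delta>\<close>. The flag in
  cell \<open>6\<close> is \<open>0\<close> when \<open>scan_degrees\<close> starts, so it can be
  reused there.\<close>

definition estimate_stationary :: prog where
  "estimate_stationary = SEQ (block [SET 5 1, DELTA 6 5 5]) (IFNZ 6 return_one
    (IFNZ 2 (SEQ scan_degrees (IFNZ 6 return_one power_iteration)) return_one))"

section \<open>Analysis of the loops\<close>

locale walk_program = walk_graph +
  fixes Q :: query_oracle and \<delta> :: real and v T L :: nat
  assumes access: "oracle_access Q G \<delta>" and v: "v < n" and delta_pos: "0 < \<delta>" and scale: "1 \<le> \<delta> * 2 ^ L"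
begin

text \<open>Covers all addresses, with two vectors behind \<open>20\<close> fixed cells, and all
  contents. The last summand dominates both \<open>K \<le> 2 ^ L\<close> and
  \<open>D \<le> 2 ^ L * (m * T)\<close>. The program does not know \<open>L\<close>; only the
  analysis uses it.\<close>

definition bound :: nat where
  "bound = 20 + 2 * n + m + T + m * T + 2 ^ L * (m * T + 1)"

sublocale bounded_machine Q bound "20 + 2 * n"
  by unfold_locales (simp add: bound_def)

lemma le_bound:
  "20 + 2 * n \<le> bound" "m \<le> bound" "T \<le> bound" "m * T \<le> bound" "2 ^ L \<le> bound"
  "2 ^ L * (m * T) \<le> bound"
  by (simp_all add: bound_def algebra_simps)

lemma const_le_bound: "x \<le> 20 + 2 * n \<Longrightarrow> x \<le> bound"
  using le_bound(1) by linarith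

lemma query_degree: "u < n \<Longrightarrow> q_indeg Q u = in_degree G u" "u < n \<Longrightarrow> q_outdeg Q u = out_degree G u"
  using access verts by (auto simp: oracle_access_def)

lemma query_delta: "q_delta Q a b \<longleftrightarrow> real a \<le> \<delta> * real b"
  using access by (simp add: oracle_access_def)

lemma query_in_neighbours:
  assumes "w < n"
  obtains e where "bij_betw e {..<in_degree G w} (in_arcs G w)"
    "\<And>i. i < in_degree G w \<Longrightarrow> q_innbr Q w i = tail G (e i)"
  using access assms verts unfolding oracle_access_def by blast

lemma query_in_neighbour_less:
  assumes "w < n" "i < in_degree G w"
  shows "q_innbr Q w i < n"
proof -
  obtain e where e: "bij_betw e {..<in_degree G w} (in_arcs G w)"
    "\<And>i. i < in_degree G w \<Longrightarrow> q_innbr Q w i = tail G (e i)"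
    using query_in_neighbours[OF assms(1)] by blast
  have "e i \<in> in_arcs G w"
    using bij_betwE[OF e(1)] assms(2) by auto
  then show ?thesis using e(2)[OF assms(2)] wf by simp
qed

lemma sum_in_neighbours:
  fixes f :: "nat \<Rightarrow> nat"
  assumes "w < n"
  shows "(\<Sum>i<in_degree G w. f (q_innbr Q w i)) = (\<Sum>e\<in>in_arcs G w. f (tail G e))"
proof -
  obtain e where e: "bij_betw e {..<in_degree G w} (in_arcs G w)"
    "\<And>i. i < in_degree G w \<Longrightarrow> q_innbr Q w i = tail G (e i)"
    using query_in_neighbours[OF assms(1)] by blast
  show ?thesis using e(2) sum.reindex_bij_betw[OF e(1), of "\<lambda>e. f (tail G e)"] by simp
qed

lemma runs_gather:
  assumes M: "good M" "M 3 = 20" "M 5 = 1" "M 7 = w" "M 11 = 0" "M 12 = in_degree G w"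
    and w: "w < n" and x: "\<And>u. u < n \<Longrightarrow> M (20 + u) = x u" and le: "next_mass G x w \<le> bound"
  shows "runs gather (9 * in_degree G w + 1) M
    (\<lambda>M'. (\<forall>a. a \<notin> {9, 11, 12, 13, 14, 15} \<longrightarrow> M' a = M a) \<and> M' 11 = next_mass G x w)"
proof -
  define share where "share u = x u div out_degree G u" for u
  define d where "d = in_degree G w"
  have total: "(\<Sum>i\<in>{0..<d}. share (q_innbr Q w i)) = next_mass G x w"
    using sum_in_neighbours[OF w, of share] by (simp add: d_def next_mass_def share_def lessThan_atLeast0)
  \<comment> \<open>Indices are consumed downwards, so every intermediate sum is a tail of the full
    sum and inherits its bound.\<close>
  have part: "(\<Sum>i\<in>{j..<d}. share (q_innbr Q w i)) \<le> bound" for j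
  proof -
    have "(\<Sum>i\<in>{j..<d}. share (q_innbr Q w i)) \<le> (\<Sum>i\<in>{0..<d}. share (q_innbr Q w i))"
      by (rule sum_mono2) auto
    then show ?thesis using total le by simp
  qed
  define I where "I M' \<longleftrightarrow> (\<forall>a. a \<notin> {9, 11, 12, 13, 14, 15} \<longrightarrow> M' a = M a) \<and> M' 12 \<le> d \<and>
    M' 11 = (\<Sum>i\<in>{M' 12..<d}. share (q_innbr Q w i))" for M'
  have "runs gather (9 * M 12 + 1) M (\<lambda>M'. I M' \<and> M' 12 = 0)"
    unfolding gather_def
  \<comment> \<open>A round takes nine steps: seven instructions, the \<open>SKIP\<close> and the
    loop test.\<close>
  proof (rule runs_while[where I = I and \<Phi> = "\<lambda>M. 9 * M 12"])
    fix M' assume M': "good M'" "I M'" "M' 12 \<noteq> 0"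
    obtain j where j: "M' 12 = Suc j" using M'(3) not0_implies_Suc by blast
    define u where "u = q_innbr Q w j"
    have jd: "j < d" using M'(2) j by (simp add: I_def)
    have u: "u < n" using query_in_neighbour_less[OF w, of j] jd by (simp add: u_def d_def)
    have regs: "M' 3 = 20" "M' 5 = 1" "M' 7 = w" "M' (20 + u) = x u"
      using M'(2) M x[OF u] by (auto simp: I_def)
    have acc: "M' 11 = (\<Sum>i\<in>{Suc j..<d}. share (q_innbr Q w i))"
      using M'(2) j by (simp add: I_def)
    have acc': "M' 11 + share u = (\<Sum>i\<in>{j..<d}. share (q_innbr Q w i))"
      unfolding acc u_def using jd by (simp add: sum.atLeast_Suc_lessThan)
    have bounds: "j \<le> bound" "20 + u \<le> bound" "u \<le> bound" "x u \<le> bound" "out_degree G u \<le> bound"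
      "x u div out_degree G u \<le> bound" "M' 11 + x u div out_degree G u \<le> bound"
      using good_le[OF M'(1), of 12] j u const_le_bound good_le[OF M'(1), of "20 + u"] regs
        out_degree_le[of u] le_bound(2) acc' part[of j]
      by (auto simp: share_def intro: order_trans[OF div_le_dividend])
    show "\<exists>k. runs (block [SUB 12 12 5, INNBR 13 7 12, ADD 9 3 13, LOAD 14 9, OUTDEG 15 13,
        DIV 14 14 15, ADD 11 11 14]) k M' (\<lambda>M''. I M'' \<and> 9 * M'' 12 + k + 1 \<le> 9 * M' 12)"
      by (rule exI, rule runs_block[OF M'(1)])
        (use j regs bounds u acc' jd M'(2) query_degree in
          \<open>auto simp: step_def I_def u_def[symmetric] share_def intro: const_le_bound\<close>)
  qed (use M in \<open>auto simp: I_def d_def\<close>)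
  then show ?thesis
    by (rule runs_weaken) (use M total in \<open>auto simp: I_def\<close>)
qed

definition setup_ok :: "mem \<Rightarrow> bool" where
  "setup_ok M \<longleftrightarrow> M 0 = n \<and> M 1 = v \<and> M 3 = 20 \<and> M 4 = 20 + n \<and> M 5 = 1"

lemma runs_sweep:
  assumes M: "good M" "setup_ok M" "M 7 = n" and x: "\<And>u. u < n \<Longrightarrow> M (20 + u) = x u"
    and le: "\<And>w. w < n \<Longrightarrow> next_mass G x w \<le> bound"
  shows "runs sweep (9 * m + 9 * n + 1) M
    (\<lambda>M'. setup_ok M' \<and> M' 2 = M 2 \<and> M' 10 = M 10 \<and> (\<forall>w<n. M' (20 + n + w) = next_mass G x w))"
proof -
  define I where "I M' \<longleftrightarrow> setup_ok M' \<and> M' 2 = M 2 \<and> M' 10 = M 10 \<and> M' 7 \<le> n \<and>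
    (\<forall>u<n. M' (20 + u) = x u) \<and> (\<forall>w. M' 7 \<le> w \<and> w < n \<longrightarrow> M' (20 + n + w) = next_mass G x w)"
    for M'
  \<comment> \<open>Each remaining vertex is charged its own in-degree, so the sweep costs
    \<open>9 * m + 9 * n\<close> instead of \<open>n\<close> times the largest degree.\<close>
  define \<Phi> where "\<Phi> M' = (\<Sum>w<M' 7. 9 * in_degree G w + 9)" for M' :: mem
  have "runs sweep (\<Phi> M + 1) M (\<lambda>M'. I M' \<and> M' 7 = 0)"
    unfolding sweep_def
  proof (rule runs_while)
    fix M' assume M': "good M'" "I M'" "M' 7 \<noteq> 0"
    obtain w where j: "M' 7 = Suc w" using M'(3) not0_implies_Suc by blast
    have w: "w < n" using M'(2) j by (simp add: I_def)
    have regs: "M' 0 = n" "M' 1 = v" "M' 2 = M 2" "M' 3 = 20" "M' 4 = 20 + n" "M' 5 = 1" "M' 10 = M 10"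
      "\<And>u. u < n \<Longrightarrow> M' (20 + u) = x u"
      "\<And>u. w < u \<Longrightarrow> u < n \<Longrightarrow> M' (20 + n + u) = next_mass G x u"
      using M'(2) j by (auto simp: I_def setup_ok_def)
    have bounds: "w \<le> bound" "20 + w \<le> bound" "in_degree G w \<le> bound" "20 + n + w \<le> bound"
      using w const_le_bound in_degree_le[of w] le_bound(2) by auto
    define S where "S M'' \<longleftrightarrow> (\<forall>a. a \<notin> {7, 11, 12} \<longrightarrow> M'' a = M' a) \<and> M'' 7 = w \<and> M'' 11 = 0 \<and>
      M'' 12 = in_degree G w" for M''
    have "runs (block [SUB 7 7 5, INDEG 12 7, SET 11 0]) (3 + 1) M' S"
      by (rule runs_block_le[OF M'(1)])
        (use regs j w bounds query_degree in \<open>auto simp: step_def S_def intro: const_le_bound\<close>)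
    then have "runs (SEQ (block [SUB 7 7 5, INDEG 12 7, SET 11 0])
        (SEQ gather (block [ADD 9 4 7, STORE 9 11]))) (3 + 1 + ((9 * in_degree G w + 1) + (2 + 1))) M'
        (\<lambda>M''. I M'' \<and> M'' 7 = w)"
    proof (rule runs_seq)
      fix M1 assume M1: "good M1" "S M1"
      have "runs gather (9 * in_degree G w + 1) M1 (\<lambda>M2. (\<forall>a. a \<notin> {9, 11, 12, 13, 14, 15} \<longrightarrow> M2 a = M1 a) \<and>
          M2 11 = next_mass G x w)"
        by (rule runs_gather) (use M1 regs w le in \<open>auto simp: S_def\<close>)
      then show "runs (SEQ gather (block [ADD 9 4 7, STORE 9 11])) ((9 * in_degree G w + 1) + (2 + 1)) M1
          (\<lambda>M''. I M'' \<and> M'' 7 = w)"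
      proof (rule runs_seq)
        fix M2 assume M2: "good M2" and R: "(\<forall>a. a \<notin> {9, 11, 12, 13, 14, 15} \<longrightarrow> M2 a = M1 a) \<and>
          M2 11 = next_mass G x w"
        have eq: "M2 a = M' a" if "a \<notin> {7, 9, 11, 12, 13, 14, 15}" for a
          using R M1(2) that by (simp add: S_def)
        have regs2: "M2 7 = w" "M2 11 = next_mass G x w" "M2 4 = 20 + n"
          using R M1(2) regs by (auto simp: S_def)
        show "runs (block [ADD 9 4 7, STORE 9 11]) (2 + 1) M2 (\<lambda>M''. I M'' \<and> M'' 7 = w)"
          by (rule runs_block_le[OF M2])
            (use regs regs2 bounds le[OF w] w in
              \<open>auto simp: step_def I_def setup_ok_def eq intro: const_le_bound\<close>)
      qed
    qed
    then have "runs (SEQ (block [SUB 7 7 5, INDEG 12 7, SET 11 0])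
        (SEQ gather (block [ADD 9 4 7, STORE 9 11]))) (9 * in_degree G w + 8) M'
        (\<lambda>M''. I M'' \<and> \<Phi> M'' + (9 * in_degree G w + 8) + 1 \<le> \<Phi> M')"
      by (rule runs_weaken) (auto simp: \<Phi>_def j)
    then show "\<exists>k. runs (SEQ (block [SUB 7 7 5, INDEG 12 7, SET 11 0])
        (SEQ gather (block [ADD 9 4 7, STORE 9 11]))) k M' (\<lambda>M''. I M'' \<and> \<Phi> M'' + k + 1 \<le> \<Phi> M')"
      by blast
  qed (use M x in \<open>auto simp: I_def\<close>)
  moreover have "\<Phi> M = 9 * m + 9 * n"
    using M(3) sum_in_degree by (simp add: \<Phi>_def sum.distrib sum_distrib_left[symmetric])
  ultimately have "runs sweep (9 * m + 9 * n + 1) M (\<lambda>M'. I M' \<and> M' 7 = 0)" by simp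
  then show ?thesis
    by (rule runs_weaken) (auto simp: I_def)
qed

lemma runs_copy_back:
  assumes M: "good M" "setup_ok M" "M 7 = n" and y: "\<And>u. u < n \<Longrightarrow> M (20 + n + u) = y u"
  shows "runs copy_back (7 * n + 1) M
    (\<lambda>M'. setup_ok M' \<and> M' 2 = M 2 \<and> M' 10 = M 10 \<and> (\<forall>u<n. M' (20 + u) = y u))"
proof -
  define I where "I M' \<longleftrightarrow> setup_ok M' \<and> M' 2 = M 2 \<and> M' 10 = M 10 \<and> M' 7 \<le> n \<and>
    (\<forall>u<n. M' (20 + n + u) = y u) \<and> (\<forall>u. M' 7 \<le> u \<and> u < n \<longrightarrow> M' (20 + u) = y u)"
    for M'
  have "runs copy_back (7 * M 7 + 1) M (\<lambda>M'. I M' \<and> M' 7 = 0)"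
    unfolding copy_back_def
  proof (rule runs_while[where \<Phi> = "\<lambda>M. 7 * M 7"])
    fix M' assume M': "good M'" "I M'" "M' 7 \<noteq> 0"
    obtain w where j: "M' 7 = Suc w" using M'(3) not0_implies_Suc by blast
    have w: "w < n" using M'(2) j by (simp add: I_def)
    have regs: "M' 0 = n" "M' 1 = v" "M' 2 = M 2" "M' 3 = 20" "M' 4 = 20 + n" "M' 5 = 1" "M' 10 = M 10"
      "\<And>u. u < n \<Longrightarrow> M' (20 + n + u) = y u"
      "\<And>u. w < u \<Longrightarrow> u < n \<Longrightarrow> M' (20 + u) = y u"
      using M'(2) j by (auto simp: I_def setup_ok_def)
    have bounds: "w \<le> bound" "20 + w \<le> bound" "20 + n + w \<le> bound" "y w \<le> bound"
      using w const_le_bound regs(8)[OF w] good_le[OF M'(1), of "20 + n + w"] by auto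
    show "\<exists>k. runs (block [SUB 7 7 5, ADD 9 4 7, LOAD 14 9, ADD 9 3 7, STORE 9 14]) k M'
        (\<lambda>M''. I M'' \<and> 7 * M'' 7 + k + 1 \<le> 7 * M' 7)"
      by (rule exI, rule runs_block[OF M'(1)])
        (use j regs bounds w in \<open>auto simp: step_def I_def setup_ok_def intro: const_le_bound\<close>)
  qed (use M y in \<open>auto simp: I_def\<close>)
  then show ?thesis
    by (rule runs_weaken) (use M(3) in \<open>auto simp: I_def\<close>)
qed

lemma runs_rounds:
  assumes M: "good M" "setup_ok M" "M 2 = T" "M 10 = D" and D: "D \<le> bound"
    and x: "\<And>u. u < n \<Longrightarrow> M (20 + u) = mass G D v 0 u"
  shows "runs rounds ((9 * m + 16 * n + 9) * T + 1) M
    (\<lambda>M'. setup_ok M' \<and> M' 10 = D \<and> (\<forall>u<n. M' (20 + u) = mass G D v T u))"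
proof -
  \<comment> \<open>The steps of one round: two counter resets, the sweep, the copying, the
    decrement of cell \<open>2\<close> and the loop test.\<close>
  define c where "c = 9 * m + 16 * n + 9"
  define I where "I M' \<longleftrightarrow> setup_ok M' \<and> M' 10 = D \<and> M' 2 \<le> T \<and>
    (\<forall>u<n. M' (20 + u) = mass G D v (T - M' 2) u)" for M'
  have "runs rounds (c * M 2 + 1) M (\<lambda>M'. I M' \<and> M' 2 = 0)"
    unfolding rounds_def
  proof (rule runs_while[where \<Phi> = "\<lambda>M. c * M 2"])
    fix M' assume M': "good M'" "I M'" "M' 2 \<noteq> 0"
    obtain j where j: "M' 2 = Suc j" using M'(3) not0_implies_Suc by blast
    define t where "t = T - Suc j"
    have t: "T - j = Suc t" "j \<le> T" "T - Suc j = t"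
      using M'(2) j by (auto simp: t_def I_def)
    define S where "S M'' \<longleftrightarrow> setup_ok M'' \<and> M'' 2 = Suc j \<and> M'' 10 = D" for M''
    have reset: "runs (block [COPY 7 0]) 2 N (\<lambda>N'. S N' \<and> N' 7 = n \<and> (\<forall>a\<ge>20. N' a = N a))"
      if "good N" "S N" for N
      by (rule runs_block_le[OF that(1)])
        (use that(2) const_le_bound[of n] in
          \<open>auto simp: step_def S_def setup_ok_def intro: const_le_bound\<close>)
    have "S M'" "\<forall>u<n. M' (20 + u) = mass G D v t u"
      using M'(2) j t by (auto simp: S_def I_def)
    from reset[OF M'(1) this(1)]
    have "runs (SEQ (block [COPY 7 0]) (SEQ sweep (SEQ (block [COPY 7 0])
        (SEQ copy_back (block [SUB 2 2 5]))))) (2 + (9 * m + 9 * n + 1 + (2 + (7 * n + 1 + 2)))) M'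
        (\<lambda>M''. I M'' \<and> M'' 2 = j)"
    proof (rule runs_seq)
      fix M1 assume M1: "good M1" "S M1 \<and> M1 7 = n \<and> (\<forall>a\<ge>20. M1 a = M' a)"
      have "runs sweep (9 * m + 9 * n + 1) M1 (\<lambda>M2. setup_ok M2 \<and> M2 2 = M1 2 \<and> M2 10 = M1 10 \<and>
          (\<forall>w<n. M2 (20 + n + w) = next_mass G (mass G D v t) w))"
      proof (rule runs_sweep)
        fix w assume "w < n"
        then show "next_mass G (mass G D v t) w \<le> bound"
          using mass_le[of w D v "Suc t"] D by simp
      qed (use M1 \<open>\<forall>u<n. M' (20 + u) = mass G D v t u\<close> in \<open>auto simp: S_def\<close>)
      then show "runs (SEQ sweep (SEQ (block [COPY 7 0]) (SEQ copy_back (block [SUB 2 2 5]))))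
          (9 * m + 9 * n + 1 + (2 + (7 * n + 1 + 2))) M1 (\<lambda>M''. I M'' \<and> M'' 2 = j)"
      proof (rule runs_seq)
        fix M2 assume M2: "good M2" "setup_ok M2 \<and> M2 2 = M1 2 \<and> M2 10 = M1 10 \<and>
          (\<forall>w<n. M2 (20 + n + w) = next_mass G (mass G D v t) w)"
        then have "S M2" using M1(2) by (simp add: S_def)
        from reset[OF M2(1) this]
        show "runs (SEQ (block [COPY 7 0]) (SEQ copy_back (block [SUB 2 2 5])))
            (2 + (7 * n + 1 + 2)) M2 (\<lambda>M''. I M'' \<and> M'' 2 = j)"
        proof (rule runs_seq)
          fix M3 assume M3: "good M3" "S M3 \<and> M3 7 = n \<and> (\<forall>a\<ge>20. M3 a = M2 a)"
          have "runs copy_back (7 * n + 1) M3 (\<lambda>M4. setup_ok M4 \<and> M4 2 = M3 2 \<and> M4 10 = M3 10 \<and>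
              (\<forall>u<n. M4 (20 + u) = next_mass G (mass G D v t) u))"
            by (rule runs_copy_back) (use M3 M2 in \<open>auto simp: S_def\<close>)
          then show "runs (SEQ copy_back (block [SUB 2 2 5])) (7 * n + 1 + 2) M3 (\<lambda>M''. I M'' \<and> M'' 2 = j)"
          proof (rule runs_seq)
            fix M4 assume M4: "good M4" "setup_ok M4 \<and> M4 2 = M3 2 \<and> M4 10 = M3 10 \<and>
              (\<forall>u<n. M4 (20 + u) = next_mass G (mass G D v t) u)"
            show "runs (block [SUB 2 2 5]) 2 M4 (\<lambda>M''. I M'' \<and> M'' 2 = j)"
              by (rule runs_block_le[OF M4(1)])
                (use M4(2) M3(2) t good_le[OF M'(1), of 2] j
                    const_le_bound[of 2] const_le_bound[of 5] in
                  \<open>auto simp: step_def S_def I_def setup_ok_def intro: const_le_bound\<close>)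
          qed
        qed
      qed
    qed
    then have "runs (SEQ (block [COPY 7 0]) (SEQ sweep (SEQ (block [COPY 7 0])
        (SEQ copy_back (block [SUB 2 2 5]))))) (c - 1) M'
        (\<lambda>M''. I M'' \<and> c * M'' 2 + (c - 1) + 1 \<le> c * M' 2)"
      by (rule runs_weaken) (auto simp: c_def j)
    then show "\<exists>k. runs (SEQ (block [COPY 7 0]) (SEQ sweep (SEQ (block [COPY 7 0])
        (SEQ copy_back (block [SUB 2 2 5]))))) k M'
        (\<lambda>M''. I M'' \<and> c * M'' 2 + k + 1 \<le> c * M' 2)"
      by blast
  qed (use M x in \<open>auto simp: I_def\<close>)
  then show ?thesis
    by (rule runs_weaken) (use M(3) in \<open>auto simp: I_def c_def\<close>)
qed

lemma runs_doubling:
  assumes M: "good M" "M 5 = 1" and \<delta>1: "\<not> 1 \<le> \<delta>"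
  shows "runs doubling (5 * L + 4) M (\<lambda>M'. (\<forall>a. a \<notin> {9, 10} \<longrightarrow> M' a = M a) \<and>
    M' 10 > 0 \<and> M' 10 \<le> 2 ^ L \<and> 1 \<le> \<delta> * real (M' 10))"
proof -
  \<comment> \<open>A failing power lies below \<open>2 ^ L\<close>, which passes by
    \<open>scale\<close>; hence the search ends with \<open>K \<le> 2 ^ L\<close>.\<close>
  have less_L: "i < L" if "\<not> 1 \<le> \<delta> * 2 ^ i" for i
  proof (rule ccontr)
    assume "\<not> i < L"
    then have "\<delta> * 2 ^ L \<le> \<delta> * 2 ^ i"
      using delta_pos by (intro mult_left_mono power_increasing) auto
    then show False using scale that by linarith
  qed
  define I where "I M' \<longleftrightarrow> (\<forall>a. a \<notin> {9, 10} \<longrightarrow> M' a = M a) \<and>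
    (\<exists>i\<le>L. M' 10 = 2 ^ i \<and> M' 9 = of_bool (\<not> 1 \<le> \<delta> * 2 ^ i))" for M'
  \<comment> \<open>For \<open>K = 2 ^ i\<close> the value of \<open>floorlog\<close> is
    \<open>i + 1\<close>, so this is \<open>5 * (L - i)\<close>. A doubling takes three
    instructions, the \<open>SKIP\<close> and the loop test.\<close>
  define \<Phi> where "\<Phi> M' = 5 * (Suc L - floorlog 2 (M' 10))" for M' :: mem
  have "runs (WHILENZ 9 (block [ADD 10 10 10, DELTA 9 5 10, SUB 9 5 9])) (\<Phi> N + 1) N
      (\<lambda>M'. I M' \<and> M' 9 = 0)" if N: "good N" "I N" for N
  proof (rule runs_while)
    fix M' assume M': "good M'" "I M'" "M' 9 \<noteq> 0"
    obtain i where i: "M' 10 = 2 ^ i" "\<not> 1 \<le> \<delta> * 2 ^ i" "i \<le> L"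
      using M'(2,3) by (auto simp: I_def)
    have iL: "i < L" using less_L i by blast
    have "(2::nat) ^ Suc i \<le> 2 ^ L" using iL by (intro power_increasing) auto
    then have le: "2 * 2 ^ i \<le> bound" using le_bound(5) by simp
    have regs: "M' 5 = 1" "\<forall>a. a \<notin> {9, 10} \<longrightarrow> M' a = M a" using M'(2) M(2) by (auto simp: I_def)
    define N' where "N' = M'(10 := 2 ^ Suc i, 9 := of_bool (\<not> 1 \<le> \<delta> * 2 ^ Suc i))"
    have fl: "floorlog 2 (2 ^ j :: nat) = Suc j" for j using floorlog_power[of 1 2 j] by (simp add: floorlog_def)
    have "I N'" using regs iL by (auto simp: I_def N'_def intro: exI[of _ "Suc i"])
    moreover have "\<Phi> N' + 4 + 1 \<le> \<Phi> M'"
      using iL fl[of i] fl[of "Suc i"] i by (simp add: \<Phi>_def N'_def)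
    moreover have "fold (step Q) [ADD 10 10 10, DELTA 9 5 10, SUB 9 5 9] M' = N'"
      using i regs by (auto simp: step_def N'_def query_delta fun_eq_iff)
    moreover have "ok [ADD 10 10 10, DELTA 9 5 10, SUB 9 5 9] M'"
      using i regs le by (auto simp: step_def intro: const_le_bound)
    ultimately have "runs (block [ADD 10 10 10, DELTA 9 5 10, SUB 9 5 9]) 4 M'
        (\<lambda>M''. I M'' \<and> \<Phi> M'' + 4 + 1 \<le> \<Phi> M')"
      by (intro runs_block_le[OF M'(1)]) (simp_all del: ok.simps fold.simps)
    then show "\<exists>k. runs (block [ADD 10 10 10, DELTA 9 5 10, SUB 9 5 9]) k M'
        (\<lambda>M''. I M'' \<and> \<Phi> M'' + k + 1 \<le> \<Phi> M')" by blast
  qed (use N in auto)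
  note loop = this
  have "runs (block [SET 10 1, SET 9 1]) 3 M (\<lambda>M'. I M' \<and> M' 10 = 1)"
    by (rule runs_block_le[OF M(1)])
      (use \<delta>1 in \<open>auto simp: step_def I_def intro: const_le_bound intro!: exI[of _ 0]\<close>)
  then have "runs doubling (3 + (5 * L + 1)) M (\<lambda>M'. I M' \<and> M' 9 = 0)"
    unfolding doubling_def
  proof (rule runs_seq)
    fix N assume N: "good N" "I N \<and> N 10 = 1"
    then have "\<Phi> N = 5 * L" by (simp add: \<Phi>_def floorlog_def)
    then show "runs (WHILENZ 9 (block [ADD 10 10 10, DELTA 9 5 10, SUB 9 5 9])) (5 * L + 1) N
        (\<lambda>M'. I M' \<and> M' 9 = 0)"
      using loop[of N] N by simp
  qed
  then show ?thesis
    by (rule runs_weaken) (auto simp: I_def of_bool_def power_increasing split: if_splits)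
qed

lemma runs_power_iteration:
  assumes M: "good M" "M 0 = n" "M 1 = v" "M 2 = T" "M 5 = 1" "M 8 = m" "\<And>a. 20 \<le> a \<Longrightarrow> M a = 0"
    and T: "T \<noteq> 0" and d: "\<forall>u<n. out_degree G u \<noteq> 0" and \<delta>1: "\<not> 1 \<le> \<delta>"
  shows "runs power_iteration (5 * L + 34 * (m * T) + 16) M (\<lambda>M'. \<exists>K D. D = K * (m * T) \<and> 0 < D \<and>
    1 \<le> \<delta> * real K \<and> M' 0 = mass G D v T v \<and> M' 1 = D)"
    (is "runs _ _ _ ?R")
proof -
  have "n \<le> m" using d by (rule n_le_m)
  then have m: "0 < m" "n * T \<le> m * T" "m \<le> m * T" using v T by auto
  have "runs power_iteration (5 * L + 4 + (7 + ((9 * m + 16 * n + 9) * T + 1 + 4))) M ?R"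
    unfolding power_iteration_def
  proof (rule runs_seq[OF runs_doubling[OF M(1,5) \<delta>1]])
    fix M1 assume M1: "good M1" and R1: "(\<forall>a. a \<notin> {9, 10} \<longrightarrow> M1 a = M a) \<and>
      M1 10 > 0 \<and> M1 10 \<le> 2 ^ L \<and> 1 \<le> \<delta> * real (M1 10)"
    define K where "K = M1 10"
    define D where "D = K * (m * T)"
    have K: "1 \<le> \<delta> * real K" using R1 by (simp add: K_def)
    have D: "0 < D" using R1 m(1) T by (simp add: D_def K_def)
    have "K * (m * T) \<le> 2 ^ L * (m * T)" using R1 by (intro mult_right_mono) (auto simp: K_def)
    then have Db: "D \<le> bound" unfolding D_def using le_bound(6) by (rule order_trans)
    have regs: "M1 0 = n" "M1 1 = v" "M1 2 = T" "M1 5 = 1" "M1 8 = m" "M1 10 = K"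
      "\<And>a. 20 \<le> a \<Longrightarrow> M1 a = 0" using R1 M by (auto simp: K_def)
    define S where "S M' \<longleftrightarrow> setup_ok M' \<and> M' 2 = T \<and> M' 10 = D \<and>
      (\<forall>u<n. M' (20 + u) = mass G D v 0 u)" for M'
    have "runs (block [MUL 8 8 2, MUL 10 10 8, SET 3 20, ADD 4 3 0, ADD 9 3 1, STORE 9 10]) 7 M1 S"
      by (rule runs_block_le[OF M1])
        (use regs v Db le_bound(4) const_le_bound[of "20 + n"] const_le_bound[of "20 + v"] in
          \<open>auto simp: step_def S_def setup_ok_def D_def intro: const_le_bound\<close>)
    then show "runs (SEQ (block [MUL 8 8 2, MUL 10 10 8, SET 3 20, ADD 4 3 0, ADD 9 3 1, STORE 9 10])
        (SEQ rounds (block [ADD 9 3 1, LOAD 0 9, COPY 1 10]))) (7 + ((9 * m + 16 * n + 9) * T + 1 + 4)) M1 ?R"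
    proof (rule runs_seq)
      fix M2 assume M2: "good M2" "S M2"
      have "runs rounds ((9 * m + 16 * n + 9) * T + 1) M2
          (\<lambda>M'. setup_ok M' \<and> M' 10 = D \<and> (\<forall>u<n. M' (20 + u) = mass G D v T u))"
        by (rule runs_rounds) (use M2 Db in \<open>auto simp: S_def simp del: mass.simps\<close>)
      then show "runs (SEQ rounds (block [ADD 9 3 1, LOAD 0 9, COPY 1 10]))
          ((9 * m + 16 * n + 9) * T + 1 + 4) M2 ?R"
      proof (rule runs_seq)
        fix M3 assume M3: "good M3" and R3: "setup_ok M3 \<and> M3 10 = D \<and> (\<forall>u<n. M3 (20 + u) = mass G D v T u)"
        show "runs (block [ADD 9 3 1, LOAD 0 9, COPY 1 10]) 4 M3 ?R"
        proof (rule runs_block_le[OF M3])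
          show "?R (fold (step Q) [ADD 9 3 1, LOAD 0 9, COPY 1 10] M3)"
            by (rule exI[of _ K], rule exI[of _ D])
              (use R3 v K D D_def in \<open>simp add: step_def setup_ok_def\<close>)
        qed (use R3 v Db good_le[OF M3, of "20 + v"] const_le_bound[of "20 + v"] in
            \<open>auto simp: step_def setup_ok_def intro: const_le_bound\<close>)
      qed
    qed
  qed
  moreover have "5 * L + 4 + (7 + ((9 * m + 16 * n + 9) * T + 1 + 4)) \<le> 5 * L + 34 * (m * T) + 16"
  proof -
    have "T \<le> m * T" using m(1) by simp
    \<comment> \<open>The constant is \<open>9 + 16 + 9\<close>, using \<open>n \<le> m\<close> and
      \<open>1 \<le> m\<close>.\<close>
    then have "9 * (m * T) + 16 * (n * T) + 9 * T \<le> 34 * (m * T)" using m(2) by linarith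
    then show ?thesis by (simp add: algebra_simps)
  qed
  ultimately show ?thesis by (rule runs_weaken) auto
qed

lemma runs_scan_degrees:
  assumes M: "good M" "M 0 = n" "M 5 = 1" "M 6 = 0" "M 8 = 0"
  shows "runs scan_degrees (8 * m + 11) M (\<lambda>M'. (\<forall>a. a \<notin> {6, 7, 8, 9} \<longrightarrow> M' a = M a) \<and>
    (if M' 6 = 0 then M' 8 = m \<and> (\<forall>u<n. out_degree G u \<noteq> 0) else \<exists>u<n. out_degree G u = 0))"
proof -
  define I where "I M' \<longleftrightarrow> (\<forall>a. a \<notin> {6, 7, 8, 9} \<longrightarrow> M' a = M a) \<and> M' 7 \<le> n \<and>
    (if M' 6 = 0 then M' 8 = (\<Sum>u\<in>{M' 7..<n}. out_degree G u) \<and>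
        (\<forall>u. M' 7 \<le> u \<and> u < n \<longrightarrow> out_degree G u \<noteq> 0)
     else M' 7 = 0 \<and> (\<exists>u<n. out_degree G u = 0))" for M'
  \<comment> \<open>An iteration takes eight steps. A vertex with outgoing arcs pays from its
    out-degree, and the indicator pays for the one possible vertex without any, after which the loop
    ends. This gives a bound in \<open>m\<close>, independent of \<open>n\<close>.\<close>
  define \<Phi> where "\<Phi> M' = 8 * ((\<Sum>u<M' 7. out_degree G u) + of_bool (M' 7 \<noteq> 0))" for M' :: mem
  have "runs (block [COPY 7 0]) 2 M (\<lambda>M'. I M' \<and> M' 7 = n)"
    by (rule runs_block_le[OF M(1)])
      (use M const_le_bound[of n] in \<open>auto simp: step_def I_def intro: const_le_bound\<close>)
  then have "runs scan_degrees (2 + (8 * m + 9)) M (\<lambda>M'. I M' \<and> M' 7 = 0)"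
    unfolding scan_degrees_def
  proof (rule runs_seq)
    fix N assume N: "good N" "I N \<and> N 7 = n"
    let ?body = "SEQ (block [SUB 7 7 5, OUTDEG 9 7])
      (IFNZ 9 (block [ADD 8 8 9]) (block [SET 6 1, SET 7 0]))"
    have "runs (WHILENZ 7 ?body) (\<Phi> N + 1) N (\<lambda>M'. I M' \<and> M' 7 = 0)"
    proof (rule runs_while)
      fix M' assume M': "good M'" "I M'" "M' 7 \<noteq> 0"
      obtain u where j: "M' 7 = Suc u" using M'(3) not0_implies_Suc by blast
      have u: "u < n" using M'(2) j by (simp add: I_def)
      have flag: "M' 6 = 0" using M'(2,3) by (auto simp: I_def split: if_splits)
      have regs: "M' 5 = 1" "M' 8 = (\<Sum>u\<in>{Suc u..<n}. out_degree G u)"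
        "\<And>w. u < w \<Longrightarrow> w < n \<Longrightarrow> out_degree G w \<noteq> 0" "\<And>a. a \<notin> {6, 7, 8, 9} \<Longrightarrow> M' a = M a"
        using M'(2) j flag M(3) by (auto simp: I_def)
      have acc: "M' 8 + out_degree G u = (\<Sum>u\<in>{u..<n}. out_degree G u)"
        using u by (simp add: regs(2) sum.atLeast_Suc_lessThan)
      also have "\<dots> \<le> m"
        unfolding sum_out_degree[symmetric] by (rule sum_mono2) auto
      finally have acc_le: "M' 8 + out_degree G u \<le> bound" using le_bound(2) by linarith
      define S where "S M'' \<longleftrightarrow> (\<forall>a. a \<notin> {7, 9} \<longrightarrow> M'' a = M' a) \<and> M'' 7 = u \<and> M'' 9 = out_degree G u" for M''
      have "runs (block [SUB 7 7 5, OUTDEG 9 7]) 3 M' S"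
        by (rule runs_block_le[OF M'(1)])
          (use regs j u acc_le query_degree const_le_bound[of u] in
            \<open>auto simp: step_def S_def intro: const_le_bound\<close>)
      then have "runs ?body (3 + (3 + 1)) M' (\<lambda>M''. I M'' \<and> \<Phi> M'' + 7 + 1 \<le> \<Phi> M')"
      proof (rule runs_seq)
        fix M1 assume M1: "good M1" "S M1"
        have regs1: "M1 6 = 0" "M1 7 = u" "M1 8 = M' 8" "M1 9 = out_degree G u"
          "\<And>a. a \<notin> {6, 7, 8, 9} \<Longrightarrow> M1 a = M a"
          using M1(2) regs flag by (auto simp: S_def)
        show "runs (IFNZ 9 (block [ADD 8 8 9]) (block [SET 6 1, SET 7 0])) (3 + 1) M1
            (\<lambda>M''. I M'' \<and> \<Phi> M'' + 7 + 1 \<le> \<Phi> M')"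
        proof (rule runs_ifnz[OF M1(1)])
          assume d: "M1 9 \<noteq> 0"
          have pos: "out_degree G w \<noteq> 0" if "u \<le> w" "w < n" for w
            using d regs1(4) regs(3) that by (cases "w = u") auto
          show "runs (block [ADD 8 8 9]) 3 M1 (\<lambda>M''. I M'' \<and> \<Phi> M'' + 7 + 1 \<le> \<Phi> M')"
            by (rule runs_block_le[OF M1(1)])
              (use regs1 acc acc_le pos u pos[of u] j in
                \<open>auto simp: step_def I_def \<Phi>_def Suc_le_eq intro: const_le_bound\<close>)
        next
          assume d: "M1 9 = 0"
          then have "\<exists>u<n. out_degree G u = 0" using u regs1(4) by auto
          then show "runs (block [SET 6 1, SET 7 0]) 3 M1 (\<lambda>M''. I M'' \<and> \<Phi> M'' + 7 + 1 \<le> \<Phi> M')"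
            by (intro runs_block_le[OF M1(1)])
              (use regs1 j in \<open>auto simp: step_def I_def \<Phi>_def intro: const_le_bound\<close>)
        qed simp
      qed
      then show "\<exists>k. runs ?body k M' (\<lambda>M''. I M'' \<and> \<Phi> M'' + k + 1 \<le> \<Phi> M')"
        by (intro exI[of _ 7]) simp
    qed (use N in auto)
    then show "runs (WHILENZ 7 ?body) (8 * m + 9) N (\<lambda>M'. I M' \<and> M' 7 = 0)"
      by (rule runs_weaken) (use N sum_out_degree in \<open>auto simp: \<Phi>_def\<close>)
  qed
  then show ?thesis
    by (rule runs_weaken) (auto simp: I_def lessThan_atLeast0[symmetric] sum_out_degree split: if_splits)
qed

section \<open>Correctness and cost of the whole program\<close>

definition estimates :: "mem \<Rightarrow> bool" where
  "estimates M \<longleftrightarrow> M 1 > 0 \<and> (\<forall>\<epsilon> \<pi>. stationary_distribution (random_walk_mat G) \<pi> \<and>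
     mixes (random_walk_mat G) T \<epsilon> \<longrightarrow> \<bar>returned M - \<pi> $ v\<bar> \<le> \<epsilon> + \<delta>)"

lemma runs_return_one:
  assumes "good M" "1 \<le> \<delta> \<or> T = 0 \<or> (\<exists>u<n. out_degree G u = 0)"
  shows "runs return_one 3 M estimates"
  unfolding return_one_def
proof (rule runs_block_le[OF assms(1)])
  show "estimates (fold (step Q) [SET 0 1, SET 1 1] M)"
    using trivial_estimate[OF _ _ v delta_pos assms(2)]
    by (auto simp: estimates_def step_def returned_def)
qed (auto simp: step_def intro: const_le_bound)

lemma input_good: "good (input_mem n v T)"
  using v le_bound(3) const_le_bound[of n] const_le_bound[of v]
  by (auto simp: good_def input_mem_def)

text \<open>The case distinction matters for time: \<open>T * m / \<delta>\<close> can be far below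
  \<open>m * T\<close> if \<open>1 \<le> \<delta>\<close>, and it vanishes for \<open>T = 0\<close>,
  so these cases must end before any scan of the graph.\<close>

lemma runs_estimate_stationary:
  "runs estimate_stationary (if 1 \<le> \<delta> \<or> T = 0 then 8 else 5 * L + 42 * (m * T) + 36)
    (input_mem n v T) estimates"
proof -
  define S where "S M \<longleftrightarrow> M 0 = n \<and> M 1 = v \<and> M 2 = T \<and> M 5 = 1 \<and> M 6 = of_bool (1 \<le> \<delta>) \<and>
    M 8 = 0 \<and> (\<forall>a\<ge>20. M a = 0)" for M :: mem
  define rest where "rest = (if 1 \<le> \<delta> \<or> T = 0 then 3 else 5 * L + 42 * (m * T) + 31)"
  have "runs (block [SET 5 1, DELTA 6 5 5]) 3 (input_mem n v T) S"
    by (rule runs_block_le[OF input_good])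
      (auto simp: step_def S_def input_mem_def query_delta intro: const_le_bound)
  then have "runs estimate_stationary (3 + (rest + 1 + 1)) (input_mem n v T) estimates"
    unfolding estimate_stationary_def
  proof (rule runs_seq)
    fix M assume M: "good M" "S M"
    have triv: "runs return_one rest M estimates" if "1 \<le> \<delta> \<or> T = 0"
      using runs_return_one[OF M(1)] that by (auto simp: rest_def)
    have main: "runs (SEQ scan_degrees (IFNZ 6 return_one power_iteration)) rest M estimates"
      if nt: "\<not> 1 \<le> \<delta>" "T \<noteq> 0"
    proof -
      have "runs (SEQ scan_degrees (IFNZ 6 return_one power_iteration))
          (8 * m + 11 + (5 * L + 34 * (m * T) + 16 + 1)) M estimates"
      proof (rule runs_seq[OF runs_scan_degrees])
        fix M1 assume M1: "good M1" and R1: "(\<forall>a. a \<notin> {6, 7, 8, 9} \<longrightarrow> M1 a = M a) \<and>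
          (if M1 6 = 0 then M1 8 = m \<and> (\<forall>u<n. out_degree G u \<noteq> 0) else \<exists>u<n. out_degree G u = 0)"
        show "runs (IFNZ 6 return_one power_iteration) (5 * L + 34 * (m * T) + 16 + 1) M1 estimates"
        proof (rule runs_ifnz[OF M1])
          assume "M1 6 \<noteq> 0"
          then have "runs return_one 3 M1 estimates" using R1 by (intro runs_return_one[OF M1]) auto
          then show "runs return_one (5 * L + 34 * (m * T) + 16) M1 estimates"
            by (rule runs_weaken) auto
        next
          assume 0: "M1 6 = 0"
          have "runs power_iteration (5 * L + 34 * (m * T) + 16) M1 (\<lambda>M'. \<exists>K D. D = K * (m * T) \<and>
              0 < D \<and> 1 \<le> \<delta> * real K \<and> M' 0 = mass G D v T v \<and> M' 1 = D)"
            by (rule runs_power_iteration) (use M1 R1 0 M(2) nt in \<open>auto simp: S_def\<close>)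
          then show "runs power_iteration (5 * L + 34 * (m * T) + 16) M1 estimates"
          proof (rule runs_weaken)
            fix M' :: mem assume "\<exists>K D. D = K * (m * T) \<and> 0 < D \<and> 1 \<le> \<delta> * real K \<and>
              M' 0 = mass G D v T v \<and> M' 1 = D"
            then obtain K D where KD: "D = K * (m * T)" "0 < D" "1 \<le> \<delta> * real K"
              "M' 0 = mass G D v T v" "M' 1 = D" by blast
            show "estimates M'"
              using scaled_estimate[OF _ _ v KD(1,2,3)] KD(2,4,5) by (auto simp: estimates_def returned_def)
          qed simp
        qed simp
      qed (use M nt in \<open>auto simp: S_def\<close>)
      then show ?thesis
      proof (rule runs_weaken)
        \<comment> \<open>The \<open>8 * m\<close> steps of the scan join the
          \<open>34 * (m * T)\<close> steps of the iteration, which explains the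
          \<open>42\<close>.\<close>
        have "m \<le> m * T" using nt by simp
        then show "8 * m + 11 + (5 * L + 34 * (m * T) + 16 + 1) \<le> rest"
          using nt unfolding rest_def by (simp only: if_False de_Morgan_disj simp_thms)
      qed
    qed
    have inner: "runs (IFNZ 2 (SEQ scan_degrees (IFNZ 6 return_one power_iteration)) return_one) (rest + 1) M estimates"
      if "\<not> 1 \<le> \<delta>"
      by (rule runs_ifnz[OF M(1)]) (use M(2) that triv main in \<open>auto simp: S_def\<close>)
    have outer: "runs return_one (rest + 1) M estimates" if "1 \<le> \<delta>"
      by (rule runs_weaken[OF triv]) (use that in auto)
    show "runs (IFNZ 6 return_one (IFNZ 2 (SEQ scan_degrees (IFNZ 6 return_one power_iteration))
        return_one)) (rest + 1 + 1) M estimates"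
      by (rule runs_ifnz[OF M(1)]) (use M(2) inner outer in \<open>auto simp: S_def split: if_splits\<close>)
  qed
  then show ?thesis by (rule runs_weaken) (auto simp: rest_def)
qed

end

section \<open>Resource bounds\<close>

lemma bits_le_log: "1 \<le> x \<Longrightarrow> real (bits x) \<le> log 2 (real x) + 1"
  by (auto simp: bits_def floorlog_def max_def)

lemma soft_log_ge_1: "0 < \<delta> \<Longrightarrow> 1 \<le> soft_log n m T \<delta>"
  unfolding soft_log_def by (subst le_log_iff) (auto simp: add_pos_nonneg add_nonneg_nonneg)

text \<open>For \<delta> above \<open>1\<close> the logarithm is negative and \<open>nat\<close>
  yields \<open>0\<close>.\<close>

definition doublings :: "real \<Rightarrow> nat" where
  "doublings \<delta> = nat \<lceil>log 2 (1 / \<delta>)\<rceil>"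

lemma doublings_sufficient:
  assumes "0 < \<delta>"
  shows "1 \<le> \<delta> * 2 ^ doublings \<delta>"
proof -
  have "1 / \<delta> = 2 powr log 2 (1 / \<delta>)" using assms by simp
  also have "\<dots> \<le> 2 powr real (doublings \<delta>)"
    unfolding doublings_def by (intro powr_mono real_nat_ceiling_ge) auto
  finally have "1 / \<delta> \<le> 2 ^ doublings \<delta>" by (simp add: powr_realpow)
  then show ?thesis using assms by (simp add: field_simps)
qed

lemma doublings_le:
  assumes "0 < \<delta>"
  shows "real (doublings \<delta>) \<le> soft_log n m T \<delta> + 1"
proof -
  have "log 2 (1 / \<delta>) \<le> soft_log n m T \<delta>"
    unfolding soft_log_def using assms by (intro log_mono) auto
  then have "real_of_int \<lceil>log 2 (1 / \<delta>)\<rceil> \<le> soft_log n m T \<delta> + 1" by linarith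
  then show ?thesis using soft_log_ge_1[OF assms, of n m T] by (auto simp: doublings_def)
qed

text \<open>Each summand is at most a constant times the cube of the argument \<open>X\<close> of
  the logarithm, so the bit length is at most \<open>6 + 3 * l\<close>.\<close>

lemma bits_bound_le:
  assumes \<delta>: "0 < \<delta>"
  shows "real (bits (20 + 2 * n + m + T + m * T + 2 ^ doublings \<delta> * (m * T + 1)))
    \<le> 10 * soft_log n m T \<delta>"
proof -
  define X where "X = 2 + real n + real m + real T + 1 / \<delta>"
  define l where "l = soft_log n m T \<delta>"
  have X: "2 \<le> X" using \<delta> by (simp add: X_def)
  have lX: "l = log 2 X" by (simp add: l_def X_def soft_log_def)
  have l: "1 \<le> l" using soft_log_ge_1[OF \<delta>] by (simp add: l_def)
  let ?B = "20 + 2 * n + m + T + m * T + 2 ^ doublings \<delta> * (m * T + 1)"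
  have mT: "real m * real T \<le> X * X"
    using \<delta> by (intro mult_mono) (auto simp: X_def)
  have "(2 :: real) ^ doublings \<delta> = 2 powr real (doublings \<delta>)" by (simp add: powr_realpow)
  also have "\<dots> \<le> 2 powr (l + 1)"
    using doublings_le[OF \<delta>] by (intro powr_mono) (auto simp: l_def)
  also have "\<dots> = 2 * X" using X by (simp add: powr_add lX)
  finally have p: "(2 :: real) ^ doublings \<delta> \<le> 2 * X" .
  have X1: "1 \<le> X * X" "X \<le> X * X" using X mult_mono[of 1 X 1 X] by auto
  have X3: "X * X \<le> X ^ 3" using X by (simp add: power3_eq_cube)
  have "(2 :: real) ^ doublings \<delta> * (real m * real T + 1) \<le> (2 * X) * (X * X + X * X)"
    using p add_mono[OF mT X1(1)] X by (intro mult_mono) auto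
  also have "\<dots> = 4 * X ^ 3" by (simp add: power3_eq_cube)
  finally have p': "(2 :: real) ^ doublings \<delta> * (real m * real T + 1) \<le> 4 * X ^ 3" .
  have "real n \<le> X" "real m \<le> X" "real T \<le> X"
    using \<delta> by (simp_all add: X_def)
  moreover have "real ?B = 20 + 2 * real n + real m + real T + real m * real T
      + 2 ^ doublings \<delta> * (real m * real T + 1)" by (simp add: algebra_simps)
  ultimately have "real ?B \<le> 20 + 4 * X + X * X + 4 * X ^ 3"
    using mT p' by linarith
  \<comment> \<open>Every lower power of \<open>X\<close> is replaced by the cube, and
    \<open>20 + 4 + 1 + 4 = 29\<close>.\<close>
  also have "\<dots> \<le> 29 * X ^ 3" using X1 X3 by linarith
  also have "\<dots> \<le> 2 ^ 5 * X ^ 3" using X by simp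
  finally have B: "real ?B \<le> 2 ^ 5 * X ^ 3" .
  have "0 < ?B" by simp
  then have pos: "0 < real ?B" unfolding of_nat_0_less_iff .
  have "real (bits ?B) \<le> log 2 (real ?B) + 1" by (rule bits_le_log) simp
  also have "log 2 (real ?B) \<le> log 2 (2 ^ 5 * X ^ 3)"
    by (rule log_mono[OF _ pos B]) simp
  also have "\<dots> = log 2 (2 ^ 5) + log 2 (X ^ 3)" using X by (subst log_mult) auto
  also have "\<dots> = 5 + 3 * l" using X by (simp only: lX log_nat_power) simp
  finally show ?thesis using l by (simp add: l_def)
qed


lemma time_bound:
  assumes \<delta>: "0 < \<delta>" and b: "real b \<le> 10 * soft_log n m T \<delta>"
    and t: "t \<le> (if 1 \<le> \<delta> \<or> T = 0 then 8 else 5 * doublings \<delta> + 42 * (m * T) + 36) * (7 * b)"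
  shows "real t \<le> 6160 * max 1 (real T * real m / \<delta>) * soft_log n m T \<delta> ^ 2"
proof -
  define l where "l = soft_log n m T \<delta>"
  define Y where "Y = max 1 (real T * real m / \<delta>)"
  define F :: nat where "F = (if 1 \<le> \<delta> \<or> T = 0 then 8 else 5 * doublings \<delta> + 42 * (m * T) + 36)"
  have l: "1 \<le> l" using soft_log_ge_1[OF \<delta>] by (simp add: l_def)
  have Y: "1 \<le> Y" by (simp add: Y_def)
  have lY: "l \<le> l * Y" "Y \<le> l * Y" "1 \<le> l * Y"
    using l Y mult_left_mono[of 1 Y l] mult_right_mono[of 1 l Y] mult_mono[of 1 l 1 Y] by auto
  \<comment> \<open>From \<open>5 * (l + 1) + 42 * Y + 36\<close>, each term being at most its
    coefficient times \<open>l * Y\<close>.\<close>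
  have F: "real F \<le> 88 * (l * Y)"
  proof (cases "1 \<le> \<delta> \<or> T = 0")
    case False
    then have "real m * real T * \<delta> \<le> real m * real T * 1"
      by (intro mult_left_mono) auto
    then have "real m * real T \<le> real T * real m / \<delta>"
      using \<delta> by (simp add: field_simps)
    then have "real m * real T \<le> Y" by (simp add: Y_def)
    moreover have "real (doublings \<delta>) \<le> l + 1"
      using doublings_le[OF \<delta>] by (simp add: l_def)
    moreover have "real F = 5 * real (doublings \<delta>) + 42 * (real m * real T) + 36"
      using False by (simp add: F_def)
    ultimately show ?thesis using lY by linarith
  next
    case True
    then have "real F = 8" by (simp add: F_def)
    then show ?thesis using lY by linarith
  qed
  have "real t \<le> real (F * (7 * b))" using t unfolding F_def of_nat_le_iff .
  also have "\<dots> = real F * (7 * real b)" by simp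
  \<comment> \<open>One logarithm counts doublings, the other is the cost of a step;
    \<open>88 * 7 * 10 = 6160\<close>.\<close>
  also have "\<dots> \<le> (88 * (l * Y)) * (7 * (10 * l))"
    using F b l Y by (intro mult_mono) (auto simp: l_def)
  also have "\<dots> = 6160 * Y * l ^ 2" by (simp add: power2_eq_square)
  finally show ?thesis by (simp add: l_def Y_def)
qed

text \<open>The constant and the exponent are enlarged to those of \<open>time_bound\<close>, so
  that one choice serves both resources.\<close>

lemma space_bound:
  assumes \<delta>: "0 < \<delta>" and b: "real b \<le> 10 * soft_log n m T \<delta>" and n: "0 < n"
    and s: "s \<le> (20 + 2 * n) * (2 * b)"
  shows "real s \<le> 6160 * real n * soft_log n m T \<delta> ^ 2"
proof -
  define l where "l = soft_log n m T \<delta>"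
  have l: "1 \<le> l" using soft_log_ge_1[OF \<delta>] by (simp add: l_def)
  have "real s \<le> real ((20 + 2 * n) * (2 * b))" using s unfolding of_nat_le_iff .
  also have "\<dots> = (20 + 2 * real n) * (2 * real b)" by simp
  also have "\<dots> \<le> (22 * real n) * (2 * (10 * l))"
    using n b l by (intro mult_mono) (auto simp: l_def)
  also have "\<dots> \<le> 6160 * real n * l" using n l by simp
  also have "\<dots> \<le> 6160 * real n * l ^ 2" using l by (intro mult_left_mono) (auto simp: power2_eq_square)
  finally show ?thesis by (simp add: l_def)
qed

text \<open>The program and both constants precede the graph and the parameters, so the algorithm is
  uniform; \<epsilon> is quantified after the run and is unknown to it. The \<open>max 1\<close>
  accounts for runs with \<open>T * m = 0\<close>, which still take some time.\<close>

theorem theorem4p9: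
  shows "\<exists>(P :: prog) (C :: real) (k :: nat).
    \<forall>(n :: nat) (G :: graph) (m :: nat) (v :: nat) (T :: nat) (\<delta> :: real) (Q :: query_oracle).
      graph_on n G \<and> m = card (arcs G) \<and> v \<in> verts G \<and> \<delta> > 0 \<and> oracle_access Q G \<delta> \<longrightarrow>
      (\<exists>(t :: nat) (s :: nat) (M :: mem).
        exec Q P (input_mem n v T) t s M \<and>
        M 1 > 0 \<and>
        (\<forall>(\<epsilon> :: real) (\<pi> :: real vec).
           stationary_distribution (random_walk_mat G) \<pi> \<and> mixes (random_walk_mat G) T \<epsilon> \<longrightarrow>
           \<bar>returned M - \<pi> $ v\<bar> \<le> \<epsilon> + \<delta>) \<and>
        real t \<le> C * max 1 (real T * real m / \<delta>) * soft_log n m T \<delta> ^ k \<and>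
        real s \<le> C * real n * soft_log n m T \<delta> ^ k)"
proof (rule exI[of _ estimate_stationary], rule exI[of _ 6160], rule exI[of _ 2], intro allI impI)
  fix n :: nat and G :: graph and m v T :: nat and \<delta> :: real and Q :: query_oracle
  assume A: "graph_on n G \<and> m = card (arcs G) \<and> v \<in> verts G \<and> \<delta> > 0 \<and> oracle_access Q G \<delta>"
  then have v: "v < n" by (auto simp: graph_on_def)
  interpret walk_program G n m Q \<delta> v T "doublings \<delta>"
    by unfold_locales (use A v doublings_sufficient in auto)
  obtain t s M where run: "exec Q estimate_stationary (input_mem n v T) t s M"
    and t: "t \<le> (if 1 \<le> \<delta> \<or> T = 0 then 8 else 5 * doublings \<delta> + 42 * (m * T) + 36) * (7 * bits bound)"
    and s: "s \<le> (20 + 2 * n) * (2 * bits bound)" and M: "estimates M"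
    using runs_estimate_stationary unfolding runs_def by blast
  have b: "real (bits bound) \<le> 10 * soft_log n m T \<delta>"
    unfolding bound_def by (rule bits_bound_le[OF delta_pos])
  have "0 < n" using v by simp
  then show "\<exists>t s M. exec Q estimate_stationary (input_mem n v T) t s M \<and> M 1 > 0 \<and>
      (\<forall>\<epsilon> \<pi>. stationary_distribution (random_walk_mat G) \<pi> \<and> mixes (random_walk_mat G) T \<epsilon> \<longrightarrow>
         \<bar>returned M - \<pi> $ v\<bar> \<le> \<epsilon> + \<delta>) \<and>
      real t \<le> 6160 * max 1 (real T * real m / \<delta>) * soft_log n m T \<delta> ^ 2 \<and>
      real s \<le> 6160 * real n * soft_log n m T \<delta> ^ 2"
    using run M time_bound[OF delta_pos b t] space_bound[OF delta_pos b _ s]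
    unfolding estimates_def by blast
qed

end
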